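(* Let $T$ be an aperiodic countable-to-one measure-preserving Borel transformation on a standard probability space $(X,\mu)$. Let $E_T$ denote the induced orbit equivalence relation and let $(x,y)\mapsto\rho_x(y):E_T\to\mathbb{R}^+$ be the Radon--Nikodym cocycle of $E_T$ with respect to $\mu$. For every $f\in L^1(X,\mu)$, for a.e. $x\in X$, we have $\sum_{y\in\tau_x}|f(y)|\rho_x(y)<\infty$ for all $\tau_x\in\mathcal{T}_x$, and \[ \frac{1}{\rho_x(\tau_x)}\sum_{y\in\tau_x}f(y)\rho_x(y)\to\overline{f}(x)\quad\text{as }\rho_x(\tau_x)\to\infty, \] where $\tau_x$ ranges over the collection $\mathcal{T}_x$ of all (possibly infinite) subtrees of the graph of $T$ of finite height rooted at $x$ and directed towards $x$, $\rho_x(\tau_x):=\sum_{y\in\tau_x}\rho_x(y)$, and $\overline{f}$ is the conditional expectation of $f$ with respect to the $\sigma$-algebra of $T$-invariant Borel sets.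
   Context: $\mathbb{N}$ includes $0$. $T$ is aperiodic if $T^n(x)\ne x$ for all $x\in X$ and $n\ge1$; countable-to-one if all $T^{-1}(x)$ are countable. $x\,E_T\,y$ iff $T^n(x)=T^m(y)$ for some $n,m\in\mathbb{N}$. A countable Borel equivalence relation $E$ on $(X,\mu)$ is null-preserving if for every partial Borel injection $\gamma$ on $X$ with graph contained in $E$, $\mathrm{dom}(\gamma)$ is null iff $\mathrm{im}(\gamma)$ is null. Standing assumption (which can be arranged by discarding a null set): $T$ is surjective and $E_T$ is null-preserving. The Radon--Nikodym cocycle of $E$ with respect to $\mu$ is the a.e. unique Borel function $\rho:E\to\mathbb{R}^+$, $(x,y)\mapsto\rho_x(y)$, with $\rho_x(y)\rho_y(z)=\rho_x(z)$ and $\int_{\mathrm{im}(\gamma)}h\,d\mu=\int_{\mathrm{dom}(\gamma)}h(\gamma(x))\rho_x(\gamma(x))\,d\mu(x)$ for all $h\in L^1(X,\mu)$ and all partial Borel injections $\gamma$ with graph contained in $E$. $\tau_x\in\mathcal{T}_x$ means: $\tau_x\subseteq\bigcup_{i=0}^nT^{-i}(x)$ for some $n\in\mathbb{N}$; $x\in\tau_x$; and if $y\in\tau_x$, $y\ne x$, then $T(y)\in\tau_x$. The convergence "as $\rho_x(\tau_x)\to\infty$" means: for every $\varepsilon>0$ there is $M>0$ such that for all $\tau_x\in\mathcal{T}_x$ with $\rho_x(\tau_x)\ge M$ the average is within $\varepsilon$ of $\overline{f}(x)$. *)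

theory Defs
  imports "HOL-Probability.Probability"
begin

(* There is no class restriction on the point type: the Polish topology lives on space M only,
   so that M may be carried by any subset of the type. *)
definition standard_borel :: "'a measure \<Rightarrow> bool" where
  "standard_borel M \<longleftrightarrow>
     (\<exists>S. completely_metrizable_space S \<and> second_countable S \<and>
          sets M = sets (sigma (topspace S) {U. openin S U}))"

definition measure_preserving_map :: "'a measure \<Rightarrow> ('a \<Rightarrow> 'a) \<Rightarrow> bool" where
  "measure_preserving_map M T \<longleftrightarrow> T \<in> measurable M M \<and> distr M M T = M"

definition aperiodic_map :: "'a set \<Rightarrow> ('a \<Rightarrow> 'a) \<Rightarrow> bool" where
  "aperiodic_map X T \<longleftrightarrow> (\<forall>x\<in>X. \<forall>n\<ge>1. (T ^^ n) x \<noteq> x)"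

definition countable_to_one :: "'a set \<Rightarrow> ('a \<Rightarrow> 'a) \<Rightarrow> bool" where
  "countable_to_one X T \<longleftrightarrow> (\<forall>x\<in>X. countable (T -` {x} \<inter> X))"

definition orbit_rel :: "'a set \<Rightarrow> ('a \<Rightarrow> 'a) \<Rightarrow> ('a \<times> 'a) set" where
  "orbit_rel X T = {(x, y). x \<in> X \<and> y \<in> X \<and> (\<exists>n m. (T ^^ n) x = (T ^^ m) y)}"

(* A partial injection is given by its domain D and a total function g of which only the
   restriction to D matters; its image is g ` D.  On a standard Borel space the image is
   automatically Borel (Lusin-Souslin), so this is not part of the definition. *)
definition partial_borel_injection ::
    "'a measure \<Rightarrow> ('a \<times> 'a) set \<Rightarrow> 'a set \<Rightarrow> ('a \<Rightarrow> 'a) \<Rightarrow> bool" where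
  "partial_borel_injection M E D g \<longleftrightarrow>
     D \<in> sets M \<and> g \<in> measurable (restrict_space M D) M \<and> inj_on g D \<and>
     (\<forall>x\<in>D. (x, g x) \<in> E)"

definition null_preserving :: "'a measure \<Rightarrow> ('a \<times> 'a) set \<Rightarrow> bool" where
  "null_preserving M E \<longleftrightarrow>
     (\<forall>D g. partial_borel_injection M E D g \<longrightarrow> (D \<in> null_sets M \<longleftrightarrow> g ` D \<in> null_sets M))"

(* rho x y stands for rho_x(y); only its values on E matter.  Integrability of the right-hand
   integrand is stated explicitly because the Bochner integral of a non-integrable function
   is 0 by convention. *)
definition radon_nikodym_cocycle ::
    "'a measure \<Rightarrow> ('a \<times> 'a) set \<Rightarrow> ('a \<Rightarrow> 'a \<Rightarrow> real) \<Rightarrow> bool" where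
  "radon_nikodym_cocycle M E \<rho> \<longleftrightarrow>
     (\<lambda>(x, y). \<rho> x y) \<in> borel_measurable (restrict_space (M \<Otimes>\<^sub>M M) E) \<and>
     (\<forall>(x, y)\<in>E. 0 < \<rho> x y) \<and>
     (\<forall>x y z. (x, y) \<in> E \<longrightarrow> (y, z) \<in> E \<longrightarrow> \<rho> x y * \<rho> y z = \<rho> x z) \<and>
     (\<forall>h D g. integrable M (h :: 'a \<Rightarrow> real) \<longrightarrow> partial_borel_injection M E D g \<longrightarrow>
        set_integrable M D (\<lambda>x. h (g x) * \<rho> x (g x)) \<and>
        (LINT x : g ` D | M. h x) = (LINT x : D | M. h (g x) * \<rho> x (g x)))"

definition rooted_trees :: "'a set \<Rightarrow> ('a \<Rightarrow> 'a) \<Rightarrow> 'a \<Rightarrow> 'a set set" where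
  "rooted_trees X T x =
     {\<tau>. (\<exists>n. \<tau> \<subseteq> (\<Union>i\<le>n. (T ^^ i) -` {x} \<inter> X)) \<and> x \<in> \<tau> \<and>
          (\<forall>y\<in>\<tau>. y \<noteq> x \<longrightarrow> T y \<in> \<tau>)}"

(* rho_x(tau).  Valued in ennreal, since tau may be infinite and the sum may a priori diverge. *)
definition tree_weight :: "('a \<Rightarrow> 'a \<Rightarrow> real) \<Rightarrow> 'a \<Rightarrow> 'a set \<Rightarrow> ennreal" where
  "tree_weight \<rho> x \<tau> = (\<Sum>\<^sub>\<infinity>y\<in>\<tau>. ennreal (\<rho> x y))"

(* If the weight is infinite then enn2real yields 0 and the average is 0, in accordance with
   the convention 1 / \<infinity> = 0. *)
definition tree_average :: "('a \<Rightarrow> 'a \<Rightarrow> real) \<Rightarrow> ('a \<Rightarrow> real) \<Rightarrow> 'a \<Rightarrow> 'a set \<Rightarrow> real" where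
  "tree_average \<rho> f x \<tau> = 1 / enn2real (tree_weight \<rho> x \<tau>) * (\<Sum>\<^sub>\<infinity>y\<in>\<tau>. f y * \<rho> x y)"

definition invariant_algebra :: "'a measure \<Rightarrow> ('a \<Rightarrow> 'a) \<Rightarrow> 'a measure" where
  "invariant_algebra M T = sigma (space M) {A \<in> sets M. T -` A \<inter> space M = A}"

(* The invariant sets already form a sigma-algebra, so generating one adds nothing. *)
lemma sets_invariant_algebra:
  assumes "T \<in> measurable M M"
  shows "sets (invariant_algebra M T) = {A \<in> sets M. T -` A \<inter> space M = A}"
proof -
  let ?I = "{A \<in> sets M. T -` A \<inter> space M = A}"
  have "sigma_algebra (space M) ?I"
    unfolding sigma_algebra_iff2
  proof (intro conjI ballI allI impI)
    show "?I \<subseteq> Pow (space M)"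
      using sets.sets_into_space by blast
    show "{} \<in> ?I"
      by simp
  next
    fix A assume "A \<in> ?I"
    moreover have "T -` (space M - A) \<inter> space M = space M - T -` A \<inter> space M"
      using measurable_space[OF assms] by blast
    ultimately show "space M - A \<in> ?I"
      by auto
  next
    fix A :: "nat \<Rightarrow> 'a set" assume A: "range A \<subseteq> ?I"
    have "T -` (\<Union>i. A i) \<inter> space M = (\<Union>i. T -` A i \<inter> space M)"
      by blast
    moreover have "(\<Union>i. T -` A i \<inter> space M) = (\<Union>i. A i)"
      using A by (intro SUP_cong) auto
    moreover have "(\<Union>i. A i) \<in> sets M"
      using A by (intro sets.countable_UN) auto
    ultimately show "(\<Union>i. A i) \<in> ?I"
      by simp
  qed
  then show ?thesis
    unfolding invariant_algebra_def by (rule sigma_algebra.sets_measure_of_eq)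
qed

lemma subalgebra_invariant_algebra:
  assumes "T \<in> measurable M M"
  shows "subalgebra M (invariant_algebra M T)"
proof -
  have "{A \<in> sets M. T -` A \<inter> space M = A} \<subseteq> Pow (space M)"
    using sets.sets_into_space by blast
  then have "space (invariant_algebra M T) = space M"
    unfolding invariant_algebra_def by (rule space_measure_of)
  then show ?thesis
    unfolding subalgebra_def using sets_invariant_algebra[OF assms] by auto
qed

end

theory Submission
  imports Defs
begin

text \<open>The proof is a version of Garsia's proof of the pointwise ergodic theorem, with the transfer operator
\<open>P\<close> of \<open>T\<close> in place of composition with \<open>T\<close>. The point is that the weighted sums of a function \<open>g\<close> over
trees have the right recursive structure: a tree rooted at \<open>x\<close> is its root together with trees rooted
at some of the preimages of \<open>x\<close>, and by the cocycle identity the supremum \<open>b\<^sub>n\<close> of the weighted sums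
over trees of height at most \<open>n\<close> satisfies \<open>b\<^sub>n\<^sub>+\<^sub>1 = g + P (max 0 b\<^sub>n)\<close>, because
\<open>P h x\<close> is the sum of \<open>h y * \<rho> x y\<close> over the preimages \<open>y\<close> of \<open>x\<close>. Let \<open>b\<^sub>n\<close> now be defined
by this recursion. The set where the sequence \<open>b\<^sub>n\<close> is unbounded is invariant up to a null set,
and integrating the recursion over it shows that the integral of \<open>g\<close> there is nonnegative (lemma
\<open>maximal_ergodic\<close>). For \<open>g = f - f' - d\<close>, where \<open>f'\<close> is the conditional expectation and
\<open>d > 0\<close>, the integral over an invariant set is \<open>-d\<close> times its measure; hence almost everywhere the sums
of \<open>g\<close> over all trees at \<open>x\<close> have a common bound, and dividing by a large weight bounds the average of
\<open>f\<close> by \<open>f' x + 2 * d\<close>, say (lemma \<open>AE_tree_average_le\<close>). The same holds for \<open>-f\<close>.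

For this argument the inequality that the fibre sums are at most \<open>P h x\<close> is enough, where
\<open>P h\<close> is defined as a Radon--Nikodym derivative (lemma \<open>finite_fibre_sum_le_transfer\<close>), and it must
hold at almost every \<open>x\<close> and simultaneously at all points of its backward orbit. Both facts
need measurable inverse branches of \<open>T\<close>, the first to apply the cocycle, the second to see that \<open>T\<close>
maps null sets into null sets. They come from a measurable selection theorem modulo null sets (lemma
\<open>measurable_section\<close>), which is derived from the representation of Borel sets as projections of closed
sets by following leftmost branches in a scheme of measurable hulls.\<close>

section \<open>Analytic sets and measurable sections\<close>

text \<open>In a Polish space these are the analytic sets. The parameter space is the Polish space of real sequences, which
contains the Baire space as a closed subset and gives the same class.\<close>
definition closed_projection :: "'a::metric_space set \<Rightarrow> bool" where
  "closed_projection A \<longleftrightarrow> (\<exists>F :: ('a \<times> (nat \<Rightarrow> real)) set. closed F \<and> A = fst ` F)"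

lemma closed_projection_closed: "closed A \<Longrightarrow> closed_projection A"
  unfolding closed_projection_def
  by (intro exI[of _ "A \<times> UNIV"]) (auto intro: closed_Times)

text \<open>The first entry of the parameter sequence chooses the member of the union, the remaining entries
are its witness.\<close>
lemma closed_projection_UN:
  fixes A :: "nat \<Rightarrow> 'a::metric_space set"
  assumes "\<And>i. closed_projection (A i)"
  shows "closed_projection (\<Union>i. A i)"
proof -
  obtain F :: "nat \<Rightarrow> ('a \<times> (nat \<Rightarrow> real)) set"
    where F: "\<And>i. closed (F i)" "\<And>i. A i = fst ` F i"
    using assms unfolding closed_projection_def by metis
  \<comment> \<open>A real entry has to encode an index by a closed condition: every index at distance less than
    \<open>1\<close> from a nonnegative entry must work, and there is always at least one, the integer part.\<close>
  define G where "G = {p :: 'a \<times> (nat \<Rightarrow> real). 0 \<le> snd p 0 \<and>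
    (\<forall>i. snd p 0 \<in> {real i - 1<..<real i + 1} \<longrightarrow> (fst p, \<lambda>n. snd p (Suc n)) \<in> F i)}"
  have cont: "continuous_on UNIV (\<lambda>p :: 'a \<times> (nat \<Rightarrow> real). snd p 0)"
    by (rule continuous_on_product_then_coordinatewise[OF continuous_on_snd[OF continuous_on_id]])
  have "closed {p :: 'a \<times> (nat \<Rightarrow> real). snd p 0 \<in> {real i - 1<..<real i + 1} \<longrightarrow> (fst p, \<lambda>n. snd p (Suc n)) \<in> F i}" for i
  proof (rule closed_Collect_imp)
    from open_vimage[OF open_greaterThanLessThan[of "real i - 1" "real i + 1"] cont]
    show "open {p :: 'a \<times> (nat \<Rightarrow> real). snd p 0 \<in> {real i - 1<..<real i + 1}}"
      by (simp only: vimage_def)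
    have "continuous_on UNIV (\<lambda>p :: 'a \<times> (nat \<Rightarrow> real). (fst p, \<lambda>n. snd p (Suc n)))"
      by (intro continuous_intros continuous_on_coordinatewise_then_product
          continuous_on_product_then_coordinatewise)
    from closed_vimage[OF F(1) this]
    show "closed {p :: 'a \<times> (nat \<Rightarrow> real). (fst p, \<lambda>n. snd p (Suc n)) \<in> F i}"
      by (simp add: vimage_def)
  qed
  then have "closed G"
    unfolding G_def by (intro closed_Collect_conj closed_Collect_all closed_Collect_le cont continuous_on_const)
  moreover have "(\<Union>i. A i) = fst ` G"
  proof safe
    fix x i assume "x \<in> A i"
    then obtain \<sigma> where "(x, \<sigma>) \<in> F i"
      using F(2) by auto
    moreover have "j = i" if "real j - 1 < real i" "real i < real j + 1" for j
      using that by linarith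
    ultimately have "(x, \<sigma>) \<in> F j" if "real j - 1 < real i" "real i < real j + 1" for j
      using that by metis
    then have "(x, case_nat (real i) \<sigma>) \<in> G"
      by (auto simp: G_def)
    then show "x \<in> fst ` G"
      by force
  next
    fix x \<sigma> assume "(x, \<sigma>) \<in> G"
    then have "(x, \<lambda>n. \<sigma> (Suc n)) \<in> F (nat \<lfloor>\<sigma> 0\<rfloor>)"
      unfolding G_def by (auto dest!: spec[of _ "nat \<lfloor>\<sigma> 0\<rfloor>"]) linarith
    then have "fst (x, \<lambda>n. \<sigma> (Suc n)) \<in> A (nat \<lfloor>\<sigma> 0\<rfloor>)"
      unfolding F(2) by (rule imageI)
    then show "fst (x, \<sigma>) \<in> (\<Union>i. A i)"
      by auto
  qed
  ultimately show ?thesis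
    unfolding closed_projection_def by blast
qed

text \<open>One parameter sequence carries a witness for every member of the intersection, by the pairing
function on the natural numbers.\<close>
lemma closed_projection_INT:
  fixes A :: "nat \<Rightarrow> 'a::metric_space set"
  assumes "\<And>i. closed_projection (A i)"
  shows "closed_projection (\<Inter>i. A i)"
proof -
  obtain F :: "nat \<Rightarrow> ('a \<times> (nat \<Rightarrow> real)) set"
    where F: "\<And>i. closed (F i)" "\<And>i. A i = fst ` F i"
    using assms unfolding closed_projection_def by metis
  define G where "G = {p :: 'a \<times> (nat \<Rightarrow> real). \<forall>i. (fst p, \<lambda>n. snd p (prod_encode (i, n))) \<in> F i}"
  have "closed {p :: 'a \<times> (nat \<Rightarrow> real). (fst p, \<lambda>n. snd p (prod_encode (i, n))) \<in> F i}" for i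
  proof -
    have "continuous_on UNIV (\<lambda>p :: 'a \<times> (nat \<Rightarrow> real). (fst p, \<lambda>n. snd p (prod_encode (i, n))))"
      by (intro continuous_intros continuous_on_coordinatewise_then_product
          continuous_on_product_then_coordinatewise)
    from closed_vimage[OF F(1) this] show ?thesis
      by (simp add: vimage_def)
  qed
  then have "closed G"
    unfolding G_def by (rule closed_Collect_all)
  moreover have "(\<Inter>i. A i) = fst ` G"
  proof safe
    fix x assume "x \<in> (\<Inter>i. A i)"
    then have "\<forall>i. \<exists>\<sigma>. (x, \<sigma>) \<in> F i"
      using F(2) by force
    then obtain \<sigma> where "\<And>i. (x, \<sigma> i) \<in> F i"
      by metis
    then have "(x, \<lambda>m. case_prod \<sigma> (prod_decode m)) \<in> G"
      by (simp add: G_def)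
    then show "x \<in> fst ` G"
      by force
  next
    fix x \<sigma> i assume "(x, \<sigma>) \<in> G"
    then have "fst (x, \<lambda>n. \<sigma> (prod_encode (i, n))) \<in> A i"
      unfolding F(2) G_def by (intro imageI) simp
    then show "fst (x, \<sigma>) \<in> A i"
      by simp
  qed
  ultimately show ?thesis
    unfolding closed_projection_def by blast
qed

text \<open>An open set is a countable union of closed sets, given by the distance to the complement.\<close>
lemma closed_projection_open:
  fixes U :: "'a::metric_space set"
  assumes "open U"
  shows "closed_projection U"
proof (cases "U = UNIV")
  case False
  have "U = (\<Union>n. {x. 1 / real (Suc n) \<le> infdist x (- U)})"
  proof safe
    fix x assume "x \<in> U"
    then have "infdist x (- U) > 0"
      using assms False in_closed_iff_infdist_zero[of "- U" x]
      by (auto simp: closed_def less_le infdist_nonneg)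
    then obtain n where "1 / real (Suc n) < infdist x (- U)"
      using nat_approx_posE by blast
    then show "x \<in> (\<Union>n. {x. 1 / real (Suc n) \<le> infdist x (- U)})"
      by (auto intro: less_imp_le)
  next
    fix x n assume *: "1 / real (Suc n) \<le> infdist x (- U)"
    show "x \<in> U"
    proof (rule ccontr)
      assume "x \<notin> U"
      then have "infdist x (- U) = 0" by (intro infdist_zero) auto
      with * show False by (simp add: divide_le_0_iff)
    qed
  qed
  moreover have "closed {x. 1 / real (Suc n) \<le> infdist x (- U)}" for n
    by (intro closed_Collect_le continuous_intros)
  ultimately show ?thesis
    using closed_projection_UN[of "\<lambda>n. {x. 1 / real (Suc n) \<le> infdist x (- U)}"]
      closed_projection_closed by metis
qed (auto intro: closed_projection_closed)

text \<open>Complements of analytic sets need not be analytic, so the induction over the Borel sets carries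
the property for a set and its complement together.\<close>
lemma closed_projection_borel:
  fixes A :: "'a::metric_space set"
  assumes "A \<in> sets borel"
  shows "closed_projection A"
proof -
  have "A \<in> sigma_sets UNIV {S. open S}"
    using assms by (simp add: borel_def)
  then have "closed_projection A \<and> closed_projection (- A)"
  proof induction
    case (Basic a)
    then show ?case
      by (auto intro: closed_projection_open closed_projection_closed)
  next
    case Empty
    then show ?case
      by (auto intro: closed_projection_closed)
  next
    case (Compl a)
    moreover have "UNIV - a = - a" by auto
    ultimately show ?case by simp
  next
    case (Union a)
    then show ?case
      using closed_projection_UN[of a] closed_projection_INT[of "\<lambda>i. - a i"] by simp
  qed
  then show ?thesis ..
qed

lemma measurable_hull:
  assumes "finite_measure M" and "Q \<subseteq> space M"
  obtains H where "H \<in> sets M" "Q \<subseteq> H"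
    "\<And>H'. H' \<in> sets M \<Longrightarrow> Q \<subseteq> H' \<Longrightarrow> H - H' \<in> null_sets M"
proof -
  interpret finite_measure M by fact
  obtain H where H: "H \<in> sets M" "Q \<subseteq> H" "outer_measure_of M Q = emeasure M H"
    using outer_measure_of_attain[OF assms(2)] by metis
  have "H - H' \<in> null_sets M" if H': "H' \<in> sets M" "Q \<subseteq> H'" for H'
  proof -
    have "outer_measure_of M Q \<le> emeasure M (H \<inter> H')"
      unfolding outer_measure_of_def using H(1,2) H' by (intro INF_lower) simp
    also have "\<dots> \<le> emeasure M H"
      using H H' by (intro emeasure_mono) auto
    finally have eq: "emeasure M (H \<inter> H') = emeasure M H"
      using H(3) \<open>outer_measure_of M Q \<le> emeasure M (H \<inter> H')\<close> \<open>emeasure M (H \<inter> H') \<le> emeasure M H\<close>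
      by simp
    have "emeasure M (H - H \<inter> H') = emeasure M H - emeasure M (H \<inter> H')"
      using H H' by (intro emeasure_Diff) (auto simp: emeasure_eq_measure)
    moreover have "H - H \<inter> H' = H - H'" by auto
    ultimately have "emeasure M (H - H') = 0"
      by (simp add: eq ennreal_diff_self emeasure_finite less_top[symmetric])
    then show ?thesis
      using H H' by auto
  qed
  then show thesis
    by (rule that[OF H(1,2)])
qed

text \<open>A continuous image of a closed subset of a Polish space is measurable up to a null set, and it has
a Borel section there. The closed set \<open>F\<close> is split by smaller and smaller balls into pieces
\<open>K s\<close> indexed by finite sequences, and the image of each piece is enclosed in a measurable hull
\<open>H s\<close> contained in the closure of that image. Because the image of \<open>K s\<close> is the union of the
images of its successors, the hulls of the successors cover \<open>H s\<close> up to a null set. Off the union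
\<open>Z\<close> of these countably many null sets, a point of \<open>H []\<close> can follow the leftmost branch of hulls
forever. The pieces along that branch shrink to one point of \<open>F\<close>, and since the hulls lie in
closures of images, continuity shows that this point is a preimage. The leftmost branch depends
measurably on the point.\<close>
lemma borel_section_closed:
  fixes F :: "'z::{complete_space, second_countable_topology} set" and \<Phi> :: "'z \<Rightarrow> 'a::metric_space"
  assumes "finite_measure N" and sets_N[measurable_cong]: "sets N = sets borel"
    and "closed F" and cont: "continuous_on UNIV \<Phi>"
  obtains A z Z where "A \<in> sets borel" "z \<in> borel_measurable borel"
    "\<And>x. x \<in> A \<Longrightarrow> z x \<in> F \<and> \<Phi> (z x) = x"
    "Z \<in> null_sets N" "\<Phi> ` F \<subseteq> A \<union> Z"
proof -
  interpret finite_measure N by fact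
  have space_N[simp]: "space N = UNIV"
    using sets_eq_imp_space_eq[OF sets_N] by simp
  obtain D :: "'z set" where D: "countable D" "\<And>X. open X \<Longrightarrow> X \<noteq> {} \<Longrightarrow> \<exists>d\<in>D. d \<in> X"
    using countable_dense_exists by metis
  define d where "d = from_nat_into D"
  have "D \<noteq> {}" using D(2)[of UNIV] by auto
  have dense: "\<exists>k. dist (d k) w \<le> e" if "e > 0" for w e
  proof -
    obtain y where "y \<in> D" "y \<in> ball w e"
      using D(2)[of "ball w e"] \<open>e > 0\<close> by auto
    then obtain k where "y = d k"
      using from_nat_into_surj[OF D(1)] unfolding d_def by metis
    then show ?thesis
      using \<open>y \<in> ball w e\<close> by (auto simp: dist_commute intro: less_imp_le)
  qed
  \<comment> \<open>\<open>K s\<close> collects the points of \<open>F\<close> that lie in the ball of radius \<open>2 ^ -i\<close> around the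
    \<open>s ! i\<close>-th point of the dense sequence, for every \<open>i < length s\<close>.\<close>
  define K where "K s = {w \<in> F. \<forall>i<length s. dist (d (s ! i)) w \<le> (1/2) ^ i}" for s
  have K_Nil: "K [] = F"
    by (simp add: K_def)
  have K_split: "K s = (\<Union>k. K (s @ [k]))" for s
  proof safe
    fix w assume "w \<in> K s"
    moreover obtain k where "dist (d k) w \<le> (1/2) ^ length s"
      using dense[of "(1/2) ^ length s"] by auto
    ultimately show "w \<in> (\<Union>k. K (s @ [k]))"
      by (auto simp: K_def nth_append less_Suc_eq)
  next
    fix w k assume "w \<in> K (s @ [k])"
    then have "dist (d ((s @ [k]) ! i)) w \<le> (1/2) ^ i" if "i < length s" for i
      using that by (simp add: K_def)
    then show "w \<in> K s"
      using \<open>w \<in> K (s @ [k])\<close> by (simp add: K_def nth_append)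
  qed
  have "\<exists>H. H \<in> sets N \<and> \<Phi> ` K s \<subseteq> H \<and> H \<subseteq> closure (\<Phi> ` K s) \<and>
      (\<forall>H'\<in>sets N. \<Phi> ` K s \<subseteq> H' \<longrightarrow> H - H' \<in> null_sets N)" for s
  proof -
    obtain H where H: "H \<in> sets N" "\<Phi> ` K s \<subseteq> H"
      "\<And>H'. H' \<in> sets N \<Longrightarrow> \<Phi> ` K s \<subseteq> H' \<Longrightarrow> H - H' \<in> null_sets N"
      using measurable_hull[OF assms(1), of "\<Phi> ` K s"] by auto
    have cl: "closure (\<Phi> ` K s) \<in> sets N"
      by (simp add: sets_N)
    have "H \<inter> closure (\<Phi> ` K s) - H' \<in> null_sets N" if "H' \<in> sets N" "\<Phi> ` K s \<subseteq> H'" for H'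
      using H(1) cl that by (intro null_sets_subset[OF H(3)[OF that]]) auto
    with H(1,2) cl closure_subset[of "\<Phi> ` K s"] show ?thesis
      by (intro exI[of _ "H \<inter> closure (\<Phi> ` K s)"]) auto
  qed
  then obtain H where H: "\<And>s. H s \<in> sets N" "\<And>s. \<Phi> ` K s \<subseteq> H s" "\<And>s. H s \<subseteq> closure (\<Phi> ` K s)"
      "\<And>s H'. H' \<in> sets N \<Longrightarrow> \<Phi> ` K s \<subseteq> H' \<Longrightarrow> H s - H' \<in> null_sets N"
    by metis
  have H_borel[measurable]: "H s \<in> sets borel" for s
    using H(1) by (simp add: sets_N)
  define Z where "Z = (\<Union>s. H s - (\<Union>k. H (s @ [k])))"
  have Z: "Z \<in> null_sets N"
    unfolding Z_def
  proof (intro null_sets_UN H(4))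
    show "(\<Union>k. H (s @ [k])) \<in> sets N" for s
      using H(1) by auto
    show "\<Phi> ` K s \<subseteq> (\<Union>k. H (s @ [k]))" for s
      using H(2) by (subst K_split) blast
  qed
  \<comment> \<open>\<open>\<beta> x n\<close> is the leftmost branch of length \<open>n\<close> and \<open>c x n\<close> its next entry.\<close>
  define \<beta> where "\<beta> x n = rec_nat [] (\<lambda>_ s. s @ [LEAST k. x \<in> H (s @ [k])]) n" for x n
  have \<beta>_simps: "\<beta> x 0 = []" "\<beta> x (Suc n) = \<beta> x n @ [LEAST k. x \<in> H (\<beta> x n @ [k])]" for x n
    by (auto simp: \<beta>_def)
  define c where "c x n = (LEAST k. x \<in> H (\<beta> x n @ [k]))" for x n
  have len: "length (\<beta> x n) = n" for x n
    by (induction n) (auto simp: \<beta>_simps)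
  have nth: "i < n \<Longrightarrow> \<beta> x n ! i = c x i" for x n i
    by (induction n) (auto simp: \<beta>_simps nth_append len c_def less_Suc_eq)
  have c_meas': "(\<lambda>x. c x n) \<in> measurable borel (count_space UNIV)"
    if "(\<lambda>x. \<beta> x n) \<in> measurable borel (count_space UNIV)" for n
    unfolding c_def
    by (rule measurable_compose_countable[OF _ that, of "\<lambda>s x. LEAST k. x \<in> H (s @ [k])"])
      measurable
  have \<beta>_meas: "(\<lambda>x. \<beta> x n) \<in> measurable borel (count_space UNIV)" for n
  proof (induction n)
    case 0
    show ?case by (simp add: \<beta>_simps)
  next
    case (Suc n)
    have "(\<lambda>x. \<beta> x n @ [c x n]) \<in> measurable borel (count_space UNIV)"
      by (rule measurable_compose_countable[OF _ Suc, of "\<lambda>s x. s @ [c x n]"],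
          rule measurable_compose_countable[OF _ c_meas'[OF Suc], of "\<lambda>k x. _ @ [k]"]) simp
    then show ?case
      by (simp add: \<beta>_simps c_def)
  qed
  note c_meas[measurable] = c_meas'[OF \<beta>_meas]
  define A where "A = H [] - Z"
  have A[measurable]: "A \<in> sets borel"
    using H(1) Z unfolding A_def by (auto simp: sets_N)
  have branch: "x \<in> H (\<beta> x n)" if "x \<in> A" for x n
  proof (induction n)
    case 0
    then show ?case using that by (simp add: A_def \<beta>_simps)
  next
    case (Suc n)
    then have "\<exists>k. x \<in> H (\<beta> x n @ [k])"
      using that by (auto simp: A_def Z_def)
    then show ?case
      unfolding \<beta>_simps by (rule LeastI_ex)
  qed
  have lim: "\<exists>w\<in>F. \<Phi> w = x \<and> (\<lambda>n. d (c x n)) \<longlonglongrightarrow> w" if "x \<in> A" for x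
  proof -
    have "\<exists>w\<in>K (\<beta> x n). dist (\<Phi> w) x < (1/2) ^ n" for n
    proof -
      have "x \<in> closure (\<Phi> ` K (\<beta> x n))"
        using branch[OF that] H(3) by blast
      then show ?thesis
        unfolding closure_approachable by (auto dest: spec[of _ "(1/2) ^ n"])
    qed
    \<comment> \<open>The ball centres along the branch and the points \<open>w n\<close> of the pieces have the same limit,
      and \<open>\<Phi> (w n)\<close> tends to \<open>x\<close>.\<close>
    then obtain w where w: "\<And>n. w n \<in> K (\<beta> x n)" "\<And>n. dist (\<Phi> (w n)) x < (1/2) ^ n"
      by metis
    have near: "dist (d (c x i)) (w n) \<le> (1/2) ^ i" if "i < n" for i n
      using w(1)[of n] that by (auto simp: K_def len nth)
    have "Cauchy (\<lambda>n. d (c x n))"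
      unfolding Cauchy_altdef2
    proof (intro allI impI)
      fix e :: real assume "e > 0"
      obtain n where n: "(1/2) ^ n < e / 2"
        using real_arch_pow_inv[of "e/2" "1/2"] \<open>e > 0\<close> by auto
      have "dist (d (c x m)) (d (c x n)) < e" if "m \<ge> n" for m
      proof -
        have "dist (d (c x m)) (d (c x n)) \<le> dist (d (c x m)) (w (Suc m)) + dist (d (c x n)) (w (Suc m))"
          by (rule dist_triangle2)
        also have "\<dots> \<le> (1/2) ^ m + (1/2) ^ n"
          using that by (intro add_mono near) auto
        also have "(1/2 :: real) ^ m \<le> (1/2) ^ n"
          using that by (intro power_decreasing) auto
        finally show ?thesis using n by simp
      qed
      then show "\<exists>N. \<forall>n\<ge>N. dist (d (c x n)) (d (c x N)) < e"
        by blast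
    qed
    then obtain l where l: "(\<lambda>n. d (c x n)) \<longlonglongrightarrow> l"
      using Cauchy_convergent convergent_def by blast
    have pow: "(\<lambda>n. (1/2 :: real) ^ n) \<longlonglongrightarrow> 0"
      by (intro LIMSEQ_power_zero) simp
    have "(\<lambda>n. dist (d (c x n)) (w (Suc n))) \<longlonglongrightarrow> 0"
      by (rule tendsto_sandwich[OF _ _ tendsto_const pow]) (auto intro!: always_eventually near)
    from tendsto_add[OF this tendsto_dist_iff[THEN iffD1, OF l]]
    have near_l: "(\<lambda>n. dist (d (c x n)) (w (Suc n)) + dist (d (c x n)) l) \<longlonglongrightarrow> 0"
      by simp
    have "(\<lambda>n. w (Suc n)) \<longlonglongrightarrow> l"
      unfolding tendsto_dist_iff[of _ l]
      by (rule tendsto_sandwich[OF _ _ tendsto_const near_l]) (auto intro!: always_eventually dist_triangle3)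
    then have wl: "w \<longlonglongrightarrow> l"
      by (simp add: filterlim_sequentially_Suc)
    have "l \<in> F"
      using w(1) by (intro closed_sequentially[OF \<open>closed F\<close> _ wl]) (auto simp: K_def)
    have "(\<lambda>n. \<Phi> (w n)) \<longlonglongrightarrow> \<Phi> l"
      using cont wl by (auto simp: continuous_on_eq_continuous_at intro: isCont_tendsto_compose)
    moreover have "(\<lambda>n. \<Phi> (w n)) \<longlonglongrightarrow> x"
      unfolding tendsto_dist_iff[of _ x]
      by (rule tendsto_sandwich[OF _ _ tendsto_const pow]) (auto intro!: always_eventually less_imp_le w)
    ultimately have "\<Phi> l = x"
      by (rule LIMSEQ_unique)
    with \<open>l \<in> F\<close> l show ?thesis by blast
  qed
  define z where "z x = (if x \<in> A then lim (\<lambda>n. d (c x n)) else undefined)" for x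
  have z: "z x \<in> F \<and> \<Phi> (z x) = x \<and> (\<lambda>n. d (c x n)) \<longlonglongrightarrow> z x" if "x \<in> A" for x
  proof -
    obtain w where w: "w \<in> F" "\<Phi> w = x" "(\<lambda>n. d (c x n)) \<longlonglongrightarrow> w"
      using lim[OF \<open>x \<in> A\<close>] by blast
    moreover have "z x = w"
      using that limI[OF w(3)] by (simp add: z_def)
    ultimately show ?thesis by simp
  qed
  have d_meas[measurable]: "d \<in> measurable (count_space UNIV) borel"
    by simp
  have "z \<in> borel_measurable borel"
  proof (rule borel_measurable_LIMSEQ_metric)
    show "(\<lambda>x. if x \<in> A then d (c x n) else undefined) \<in> borel_measurable borel" for n
      by measurable
    show "(\<lambda>n. if x \<in> A then d (c x n) else undefined) \<longlonglongrightarrow> z x" for x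
      using z[of x] by (cases "x \<in> A") (simp_all add: z_def[of x])
  qed
  moreover have "\<Phi> ` F \<subseteq> A \<union> Z"
    using H(2)[of "[]"] by (auto simp: A_def K_Nil)
  ultimately show thesis
    using that[OF A] z Z by blast
qed

section \<open>Standard Borel spaces\<close>

text \<open>A point of a separable complete metric space is determined by its distances to a dense sequence
\<open>D\<close>, and completeness describes which real sequences arise in this way: the triangle inequalities
with respect to the distances between the \<open>D i\<close> must hold, and the values must come arbitrarily
close to \<open>0\<close>. The indices with small values then form a Cauchy sequence whose limit realizes the
given distances. These are countably many conditions, so the range \<open>Y\<close> is Borel; the balls around
the \<open>D i\<close> become the sets where one coordinate is bounded, so Borel sets have Borel images.\<close>
lemma standard_borel_embedding:
  assumes "standard_borel M" and ne: "space M \<noteq> {}"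
  obtains e :: "'a \<Rightarrow> nat \<Rightarrow> real" where
    "inj_on e (space M)" "e \<in> borel_measurable M" "\<And>A. A \<in> sets M \<Longrightarrow> e ` A \<in> sets borel"
proof -
  obtain S :: "'a topology" where S: "completely_metrizable_space S" "second_countable S"
      "sets M = sets (sigma (topspace S) {U. openin S U})"
    using assms(1) unfolding standard_borel_def by blast
  obtain X d where Xd: "Metric_space X d" "Metric_space.mcomplete X d" "S = Metric_space.mtopology X d"
    using S(1) unfolding completely_metrizable_space_def by blast
  interpret Metric_space X d by fact
  have sub: "{U. openin S U} \<subseteq> Pow X"
    using openin_subset[of S] by (auto simp: Xd(3))
  have sets_M: "sets M = sigma_sets X {U. openin S U}"
    using S(3) sub by (simp add: Xd(3))
  have space_M: "space M = X"
    using sets_eq_imp_space_eq[OF S(3)] sub by (simp add: Xd(3) space_measure_of)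
  have open_M: "U \<in> sets M" if "openin S U" for U
    unfolding sets_M using that by (intro sigma_sets.Basic) auto
  obtain C where C: "countable C" "C \<subseteq> X" "mtopology closure_of C = X"
    using second_countable_imp_separable_space[OF S(2)] unfolding separable_space_def Xd(3) by auto
  have "C \<noteq> {}"
    using C(3) ne space_M by auto
  define D where "D = from_nat_into C"
  have D_X[simp]: "D i \<in> X" for i
    using from_nat_into[OF \<open>C \<noteq> {}\<close>] C(2) by (auto simp: D_def)
  have dense: "\<exists>i. d x (D i) < r" if "x \<in> X" "r > 0" for x r
  proof -
    have "x \<in> mtopology closure_of C"
      using that C(3) by simp
    then obtain y where "y \<in> C" "y \<in> mball x r"
      using \<open>r > 0\<close> unfolding metric_closure_of by blast
    moreover obtain i where "y = D i"
      using from_nat_into_surj[OF C(1) \<open>y \<in> C\<close>] unfolding D_def by metis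
    ultimately show ?thesis by (auto simp: in_mball)
  qed
  define e where "e x i = d x (D i)" for x i
  define Y where "Y = {a :: nat \<Rightarrow> real. (\<forall>k. \<exists>i. a i < 1 / real (Suc k)) \<and>
    (\<forall>i j. \<bar>a i - a j\<bar> \<le> d (D i) (D j) \<and> d (D i) (D j) \<le> a i + a j)}"
  have Y_borel[measurable]: "Y \<in> sets borel"
    unfolding Y_def by measurable
  have e_Y: "e x \<in> Y" if "x \<in> X" for x
    unfolding Y_def mem_Collect_eq
  proof (intro conjI allI)
    show "\<exists>i. e x i < 1 / real (Suc k)" for k
      using dense[OF that, of "1 / real (Suc k)"] by (simp add: e_def)
    show "d (D i) (D j) \<le> e x i + e x j" for i j
      using triangle''[of "D i" x "D j"] that commute[of x] by (simp add: e_def)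
    show "\<bar>e x i - e x j\<bar> \<le> d (D i) (D j)" for i j
      using mdist_reverse_triangle[of "D i" x "D j"] that commute[of x] by (simp add: e_def)
  qed
  have Y_e: "\<exists>x\<in>X. e x = a" if a: "a \<in> Y" for a
  proof -
    have "\<forall>k. \<exists>i. a i < 1 / real (Suc k)"
      using a by (simp add: Y_def)
    then obtain i where i: "\<And>k. a (i k) < 1 / real (Suc k)"
      by metis
    have a1: "\<bar>a j - a l\<bar> \<le> d (D j) (D l)" and a2: "d (D j) (D l) \<le> a j + a l" for j l
      using a by (auto simp: Y_def)
    have small: "(\<lambda>k. 1 / real (Suc k)) \<longlonglongrightarrow> 0"
      using LIMSEQ_inverse_real_of_nat by (simp add: inverse_eq_divide)
    have "MCauchy (\<lambda>k. D (i k))"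
      unfolding MCauchy_def
    proof (intro conjI allI impI)
      show "range (\<lambda>k. D (i k)) \<subseteq> X" by auto
      fix r :: real assume "r > 0"
      then obtain n where n: "1 / real (Suc n) < r / 2"
        using nat_approx_posE[of "r / 2"] by auto
      have *: "a (i k) < r / 2" if "k \<ge> n" for k
      proof -
        have "1 / real (Suc k) \<le> 1 / real (Suc n)"
          using that by (intro divide_left_mono) auto
        then show ?thesis using i[of k] n by linarith
      qed
      then have "d (D (i k)) (D (i l)) < r" if "k \<ge> n" "l \<ge> n" for k l
        using a2[of "i k" "i l"] *[OF that(1)] *[OF that(2)] by linarith
      then show "\<exists>N. \<forall>n n'. N \<le> n \<longrightarrow> N \<le> n' \<longrightarrow> d (D (i n)) (D (i n')) < r"
        by blast
    qed
    then obtain x where x: "limitin mtopology (\<lambda>k. D (i k)) x sequentially"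
      using Xd(2) unfolding mcomplete_def by blast
    then have xX: "x \<in> X"
      using limitin_mspace by blast
    have lim: "(\<lambda>k. d (D (i k)) x) \<longlonglongrightarrow> 0"
      using x unfolding limitin_metric_dist_null by simp
    have lim2: "(\<lambda>k. b + (1 / real (Suc k) + d (D (i k)) x)) \<longlonglongrightarrow> b" for b
      using tendsto_add[OF tendsto_const tendsto_add[OF small lim], of b] by simp
    have "e x j = a j" for j
    proof (rule antisym)
      show "e x j \<le> a j"
      proof (rule LIMSEQ_le_const[OF lim2[of "a j"]], intro exI allI impI)
        fix k
        have "d x (D j) \<le> d x (D (i k)) + d (D (i k)) (D j)"
          by (rule triangle) (auto simp: xX)
        then show "e x j \<le> a j + (1 / real (Suc k) + d (D (i k)) x)"
          using a2[of "i k" j] i[of k] commute[of x "D (i k)"] unfolding e_def by linarith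
      qed
      show "a j \<le> e x j"
      proof (rule LIMSEQ_le_const[OF lim2[of "e x j"]], intro exI allI impI)
        fix k
        have "d (D j) (D (i k)) \<le> d (D j) x + d x (D (i k))"
          by (rule triangle) (auto simp: xX)
        then show "a j \<le> e x j + (1 / real (Suc k) + d (D (i k)) x)"
          using a1[of j "i k"] i[of k] commute[of x "D (i k)"] commute[of x "D j"] unfolding e_def by linarith
      qed
    qed
    then show ?thesis using xX by auto
  qed
  have eX: "e ` X = Y"
    using e_Y Y_e by auto
  have inj: "inj_on e X"
  proof (rule inj_onI, rule ccontr)
    fix x y assume xy: "x \<in> X" "y \<in> X" "e x = e y" "x \<noteq> y"
    then obtain i where i: "d x (D i) < d x y / 2"
      using dense[of x "d x y / 2"] by (auto simp: mdist_pos_less)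
    moreover have "d y (D i) = d x (D i)"
      using fun_cong[OF xy(3), of i] by (simp add: e_def)
    moreover have "d x y \<le> d x (D i) + d y (D i)"
      using triangle[of x "D i" y] commute[of y "D i"] xy by simp
    ultimately show False by simp
  qed
  have "(\<lambda>x. e x i) \<in> borel_measurable M" for i
    unfolding borel_measurable_iff_less
  proof
    fix r
    have "{x \<in> space M. e x i < r} = mball (D i) r"
      by (auto simp: space_M in_mball e_def commute)
    then show "{x \<in> space M. e x i < r} \<in> sets M"
      using open_M[of "mball (D i) r"] by (simp add: Xd(3))
  qed
  then have e_meas: "e \<in> borel_measurable M"
    by (rule measurable_coordinatewise_then_product)
  have ball: "e ` mball (D i) r = {a \<in> Y. a i < r}" for i r
    unfolding eX[symmetric] by (auto simp: in_mball e_def commute)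
  have "e ` A \<in> sets borel" if "A \<in> sets M" for A
    using that unfolding sets_M
  proof induction
    case (Basic U)
    then have U: "openin mtopology U" by (simp add: Xd(3))
    have "U = (\<Union>(i, k)\<in>{(i, k). mball (D i) (1 / real (Suc k)) \<subseteq> U}. mball (D i) (1 / real (Suc k)))"
    proof safe
      fix x assume "x \<in> U"
      then obtain r where r: "r > 0" "mball x r \<subseteq> U" and xX: "x \<in> X"
        using U unfolding openin_mtopology by blast
      obtain k where k: "1 / real (Suc k) < r / 2"
        using nat_approx_posE[of "r / 2"] r by auto
      obtain i where i: "d x (D i) < 1 / real (Suc k)"
        using dense[OF xX, of "1 / real (Suc k)"] by auto
      have "mball (D i) (1 / real (Suc k)) \<subseteq> mball x r"
        using i k xX commute[of x "D i"] by (intro mball_subset) auto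
      then show "x \<in> (\<Union>(i, k)\<in>{(i, k). mball (D i) (1 / real (Suc k)) \<subseteq> U}. mball (D i) (1 / real (Suc k)))"
        using r i xX commute[of x "D i"] by (force simp: in_mball)
    qed auto
    then have "e ` U = (\<Union>(i, k)\<in>{(i, k). mball (D i) (1 / real (Suc k)) \<subseteq> U}. e ` mball (D i) (1 / real (Suc k)))"
      by (metis (no_types, lifting) case_prod_beta image_UN SUP_cong)
    also have "\<dots> \<in> sets borel"
      unfolding ball by (intro sets.countable_UN') auto
    finally show ?case .
  next
    case (Compl A)
    moreover have "A \<subseteq> X"
      using Compl(1) sub by (metis PowD sigma_sets_into_sp)
    ultimately show ?case
      using inj_on_image_set_diff[OF inj, of X A] eX by auto
  qed (auto simp: image_UN)
  with inj e_meas show thesis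
    using that space_M by blast
qed

text \<open>This replaces the uniformization theorems of descriptive set theory by a version modulo null sets.
Through the embedding, the graph of \<open>T\<close> over \<open>C\<close> becomes a Borel set of pairs, hence the
projection of a closed set, and the section of that closed set over the first coordinate is carried
back. That \<open>C\<close> may itself be a null set is essential later on.\<close>
lemma measurable_section:
  assumes "standard_borel M" "finite_measure M"
    and T[measurable]: "T \<in> measurable M M" and C: "C \<in> sets M"
  obtains A s Z where "A \<in> sets M" "s \<in> measurable (restrict_space M A) M"
    "\<And>x. x \<in> A \<Longrightarrow> s x \<in> C \<and> T (s x) = x" "Z \<in> null_sets M" "T ` C \<subseteq> A \<union> Z"
proof (cases "space M = {}")
  case True
  then have "C = {}" using sets.sets_into_space[OF C] by simp
  then show thesis
    by (intro that[of "{}" id "{}"]) (auto simp: measurable_def space_restrict_space)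
next
  case False
  then obtain e :: "'a \<Rightarrow> nat \<Rightarrow> real" where e: "inj_on e (space M)" "e \<in> borel_measurable M"
      "\<And>A. A \<in> sets M \<Longrightarrow> e ` A \<in> sets borel"
    using standard_borel_embedding[OF assms(1)] by blast
  note e(2)[measurable]
  interpret finite_measure M by fact
  define Y where "Y = e ` space M"
  have Y[measurable]: "Y \<in> sets borel" "e ` C \<in> sets borel"
    using e(3) C by (auto simp: Y_def)
  define i where "i = inv_into (space M) e"
  have ie: "i (e x) = x" if "x \<in> space M" for x
    using that e(1) by (simp add: i_def)
  have i_meas: "i \<in> measurable (restrict_space borel Y) M"
  proof (rule measurableI)
    show "i b \<in> space M" if "b \<in> space (restrict_space borel Y)" for b
      using that by (auto simp: space_restrict_space Y_def ie)
    show "i -` A \<inter> space (restrict_space borel Y) \<in> sets (restrict_space borel Y)" if "A \<in> sets M" for A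
    proof -
      have "i -` A \<inter> space (restrict_space borel Y) = e ` A"
        using sets.sets_into_space[OF that] by (auto simp: space_restrict_space Y_def ie)
      moreover have "e ` A \<subseteq> Y"
        using sets.sets_into_space[OF that] by (auto simp: Y_def)
      ultimately show ?thesis
        using e(3)[OF that] by (auto simp: sets_restrict_space_iff)
    qed
  qed
  define g where "g b = (if b \<in> Y then e (T (i b)) else (\<lambda>_. 0))" for b
  have g[measurable]: "g \<in> borel_measurable borel"
    unfolding g_def
  proof (rule measurable_If_restrict_space_iff[THEN iffD2], goal_cases)
    case 2
    have "(\<lambda>x. e (T (i x))) \<in> measurable (restrict_space borel Y) borel"
      using measurable_compose[OF i_meas measurable_compose[OF T e(2)]] by simp
    then show ?case by simp
  qed simp
  define B where "B = {p :: (nat \<Rightarrow> real) \<times> (nat \<Rightarrow> real). snd p \<in> e ` C \<and> fst p = g (snd p)}"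
  have "{p \<in> space (borel \<Otimes>\<^sub>M borel). snd p \<in> e ` C \<and> fst p = g (snd p)} \<in>
      sets (borel \<Otimes>\<^sub>M (borel :: (nat \<Rightarrow> real) measure))"
    by measurable
  then have "B \<in> sets borel"
    by (simp add: B_def space_pair_measure flip: borel_prod)
  then obtain F :: "(((nat \<Rightarrow> real) \<times> (nat \<Rightarrow> real)) \<times> (nat \<Rightarrow> real)) set"
    where F: "closed F" "B = fst ` F"
    using closed_projection_borel[of B] unfolding closed_projection_def by metis
  define N where "N = distr M borel e"
  have fin: "finite_measure N"
    unfolding N_def by (rule finite_measure_distr) simp
  have cont: "continuous_on UNIV
      (\<lambda>q :: ((nat \<Rightarrow> real) \<times> (nat \<Rightarrow> real)) \<times> (nat \<Rightarrow> real). fst (fst q))"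
    by (intro continuous_intros)
  have sets_N: "sets N = sets borel"
    by (simp add: N_def)
  obtain A0 z Z0 where A0: "A0 \<in> sets borel" "z \<in> borel_measurable borel"
    "\<And>x. x \<in> A0 \<Longrightarrow> z x \<in> F \<and> fst (fst (z x)) = x"
    "Z0 \<in> null_sets N" "(\<lambda>q. fst (fst q)) ` F \<subseteq> A0 \<union> Z0"
    using borel_section_closed[OF fin sets_N F(1) cont] by metis
  define A where "A = e -` A0 \<inter> space M"
  define Z where "Z = e -` Z0 \<inter> space M"
  define b where "b x = snd (fst (z (e x)))" for x
  have [measurable]: "A \<in> sets M"
    using A0(1) by (simp add: A_def)
  have "Z \<in> null_sets M"
    using A0(4) by (auto simp: Z_def N_def null_sets_distr_iff)
  have b: "b x \<in> e ` C \<and> e x = g (b x)" if "x \<in> A" for x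
  proof -
    have "fst (z (e x)) \<in> B" "fst (fst (z (e x))) = e x"
      using A0(3)[of "e x"] that by (auto simp: F(2) A_def)
    then show ?thesis
      by (simp add: B_def b_def)
  qed
  have CM: "C \<subseteq> space M"
    using sets.sets_into_space[OF C] .
  have "i (b x) \<in> C \<and> T (i (b x)) = x" if x: "x \<in> A" for x
  proof -
    obtain y where y: "y \<in> C" "b x = e y"
      using b[OF x] by auto
    then have "i (b x) = y" using CM by (auto simp: ie)
    moreover have "y \<in> space M" using y CM by auto
    then have "g (e y) = e (T y)"
      by (simp add: g_def Y_def ie)
    then have "e x = e (T y)"
      using b[OF x] y by simp
    then have "x = T y"
      using e(1) x y(1) CM measurable_space[OF T] by (auto simp: inj_on_def A_def)
    ultimately show ?thesis using y by simp
  qed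
  moreover have "b \<in> measurable (restrict_space M A) (restrict_space borel Y)"
  proof (rule measurable_restrict_space2)
    show "b \<in> space (restrict_space M A) \<rightarrow> Y"
      using b CM by (force simp: space_restrict_space Y_def)
    have "(\<lambda>x. z (e x)) \<in> borel_measurable M"
      using A0(2) by measurable
    then have "b \<in> borel_measurable M"
      unfolding b_def borel_prod[symmetric] by measurable
    then show "b \<in> measurable (restrict_space M A) borel"
      by (rule measurable_restrict_space1)
  qed
  then have "(\<lambda>x. i (b x)) \<in> measurable (restrict_space M A) M"
    using i_meas by (rule measurable_compose)
  moreover have "T ` C \<subseteq> A \<union> Z"
  proof safe
    fix y assume y: "y \<in> C" "T y \<notin> Z"
    then have yM: "y \<in> space M" "T y \<in> space M"
      using CM measurable_space[OF T] by auto
    then have "(e (T y), e y) \<in> B"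
      using y by (auto simp: B_def g_def Y_def ie)
    then obtain q where "q \<in> F" "fst q = (e (T y), e y)"
      unfolding F(2) by force
    then have "e (T y) \<in> A0 \<union> Z0"
      using A0(5) by force
    then show "T y \<in> A"
      using y yM by (auto simp: A_def Z_def)
  qed
  ultimately show thesis
    using that[of A "\<lambda>x. i (b x)" Z] \<open>A \<in> sets M\<close> \<open>Z \<in> null_sets M\<close> by blast
qed

section \<open>The cocycle and inverse branches\<close>

lemma (in finite_measure) AE_le_if_set_integrals_le:
  fixes u v :: "'a \<Rightarrow> real"
  assumes [simp]: "integrable M u" "integrable M v"
    and le: "\<And>A. A \<in> sets M \<Longrightarrow> (LINT x:A|M. u x) \<le> (LINT x:A|M. v x)"
  shows "AE x in M. u x \<le> v x"
proof -
  have [measurable]: "u \<in> borel_measurable M" "v \<in> borel_measurable M"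
    using assms(1,2) by (auto intro: borel_measurable_integrable)
  define A where "A = {x \<in> space M. v x < u x}"
  have A[measurable]: "A \<in> sets M"
    unfolding A_def by measurable
  have int: "integrable M (\<lambda>x. indicator A x * u x)" "integrable M (\<lambda>x. indicator A x * v x)"
    using integrable_mult_indicator[OF A, of u] integrable_mult_indicator[OF A, of v] by auto
  have int': "integrable M (\<lambda>x. indicator A x * u x - indicator A x * v x)"
    using int by (rule Bochner_Integration.integrable_diff)
  have pos: "0 \<le> indicator A x * u x - indicator A x * v x" for x
    by (auto simp: A_def indicator_def)
  have "(\<integral>x. indicator A x * u x - indicator A x * v x \<partial>M) \<le> 0"
    using le[OF A] int by (simp add: set_lebesgue_integral_def)
  moreover have "(\<integral>x. indicator A x * u x - indicator A x * v x \<partial>M) \<ge> 0"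
    by (intro integral_nonneg_AE AE_I2 pos)
  ultimately have "AE x in M. indicator A x * u x - indicator A x * v x = 0"
    using integral_nonneg_eq_0_iff_AE[OF int'] pos by auto
  with AE_space show ?thesis
    by eventually_elim (auto simp: A_def indicator_def split: if_splits)
qed

locale cocycle_system = prob_space M
  for M :: "'a measure" and T :: "'a \<Rightarrow> 'a" and \<rho> :: "'a \<Rightarrow> 'a \<Rightarrow> real" +
  assumes standard_borel: "standard_borel M"
    and measure_preserving: "measure_preserving_map M T"
    and aperiodic: "aperiodic_map (space M) T"
    and null_preserving: "null_preserving M (orbit_rel (space M) T)"
    and cocycle: "radon_nikodym_cocycle M (orbit_rel (space M) T) \<rho>"
begin

abbreviation "E \<equiv> orbit_rel (space M) T"

lemma T_measurable[measurable]: "T \<in> measurable M M"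
  and distr_T: "distr M M T = M"
  using measure_preserving by (auto simp: measure_preserving_map_def)

lemma T_space[simp]: "x \<in> space M \<Longrightarrow> T x \<in> space M"
  using measurable_space[OF T_measurable] .

lemma funpow_T_space[simp]: "x \<in> space M \<Longrightarrow> (T ^^ n) x \<in> space M"
  by (induction n) auto

lemma orbit_relI: "x \<in> space M \<Longrightarrow> y \<in> space M \<Longrightarrow> (T ^^ n) x = (T ^^ m) y \<Longrightarrow> (x, y) \<in> E"
  by (auto simp: orbit_rel_def)

lemma E_preimage: "y \<in> space M \<Longrightarrow> (T y, y) \<in> E"
  by (rule orbit_relI[of _ _ 0 1]) auto

lemma rho_pos: "(x, y) \<in> E \<Longrightarrow> 0 < \<rho> x y"
  and rho_mult: "(x, y) \<in> E \<Longrightarrow> (y, z) \<in> E \<Longrightarrow> \<rho> x y * \<rho> y z = \<rho> x z"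
  using cocycle unfolding radon_nikodym_cocycle_def by blast+

lemma rho_refl: "x \<in> space M \<Longrightarrow> \<rho> x x = 1"
  using rho_mult[of x x x] rho_pos[of x x] orbit_relI[of x x 0 0] by auto

lemma change_of_variables:
  assumes "integrable M h" "partial_borel_injection M E D g"
  shows "set_integrable M D (\<lambda>x. h (g x) * \<rho> x (g x))"
    and "(LINT x : g ` D | M. h x) = (LINT x : D | M. h (g x) * \<rho> x (g x))"
  using cocycle assms unfolding radon_nikodym_cocycle_def by blast+

lemma rho_preimage_measurable[measurable]: "(\<lambda>y. \<rho> (T y) y) \<in> borel_measurable M"
proof -
  have "(\<lambda>y. (T y, y)) \<in> measurable M (restrict_space (M \<Otimes>\<^sub>M M) E)"
    by (intro measurable_restrict_space2) (auto intro: E_preimage)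
  moreover have "(\<lambda>(x, y). \<rho> x y) \<in> borel_measurable (restrict_space (M \<Otimes>\<^sub>M M) E)"
    using cocycle unfolding radon_nikodym_cocycle_def by blast
  ultimately show ?thesis
    by (auto dest: measurable_compose)
qed

lemma emeasure_vimage_T: "A \<in> sets M \<Longrightarrow> emeasure M (T -` A \<inter> space M) = emeasure M A"
  using emeasure_distr[OF T_measurable, of A] by (simp add: distr_T)

lemma AE_T: "AE x in M. P x \<Longrightarrow> AE x in M. P (T x)"
  using AE_distrD[OF T_measurable, of P] unfolding distr_T .

lemma AE_funpow_T: "AE x in M. P x \<Longrightarrow> AE x in M. P ((T ^^ n) x)"
proof (induction n)
  case (Suc n)
  from AE_T[OF Suc.IH[OF Suc.prems]] show ?case
    by (simp add: funpow_swap1)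
qed simp

text \<open>The change of variables formula forces images to be measurable: an indicator function that is not
measurable has integral \<open>0\<close>, and then the positive function \<open>\<rho>\<close> has integral \<open>0\<close> over the domain,
so the domain is null and by null preservation the image is null as well.\<close>
lemma image_partial_injection_measurable:
  assumes pbi: "partial_borel_injection M E D g"
  shows "g ` D \<in> sets M"
proof (rule ccontr)
  assume no: "g ` D \<notin> sets M"
  have D[measurable]: "D \<in> sets M" and gE: "\<And>x. x \<in> D \<Longrightarrow> (x, g x) \<in> E"
    using pbi by (auto simp: partial_borel_injection_def)
  have sub: "g ` D \<subseteq> space M"
    using gE by (auto simp: orbit_rel_def)
  have "\<not> integrable M (\<lambda>x. indicator (g ` D) x *\<^sub>R (1 :: real))"
  proof
    assume "integrable M (\<lambda>x. indicator (g ` D) x *\<^sub>R (1 :: real))"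
    then have "(indicator (g ` D) :: 'a \<Rightarrow> real) \<in> borel_measurable M"
      using borel_measurable_integrable by force
    then have "g ` D \<inter> space M \<in> sets M"
      by (simp add: borel_measurable_indicator_iff)
    with no sub show False
      by (simp add: Int_absorb2)
  qed
  then have "(LINT x : g ` D | M. (1 :: real)) = 0"
    unfolding set_lebesgue_integral_def by (rule not_integrable_integral_eq)
  moreover have int: "integrable M (\<lambda>x. indicator D x * \<rho> x (g x))"
    using change_of_variables(1)[OF _ pbi, of "\<lambda>_. 1"] by (simp add: set_integrable_def)
  moreover have pos: "0 \<le> indicator D x * \<rho> x (g x)" for x
    using rho_pos[OF gE, of x] by (auto simp: indicator_def)
  ultimately have "AE x in M. indicator D x * \<rho> x (g x) = 0"
    using change_of_variables(2)[OF _ pbi, of "\<lambda>_. 1"] integral_nonneg_eq_0_iff_AE[OF int]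
    by (simp add: set_lebesgue_integral_def)
  then have "AE x in M. x \<notin> D"
    by eventually_elim (use rho_pos[OF gE] in \<open>force simp: indicator_def split: if_splits\<close>)
  then have "D \<in> null_sets M"
    using AE_iff_null_sets[OF D] by simp
  then have "g ` D \<in> null_sets M"
    using null_preserving pbi unfolding null_preserving_def by blast
  with no show False by auto
qed

text \<open>Measurable inverse branches of \<open>T\<close> are partial injections of the orbit relation, so the cocycle
identity applies to them.\<close>
lemma section_partial_injection:
  assumes "A \<in> sets M" "s \<in> measurable (restrict_space M A) M"
    and "\<And>x. x \<in> A \<Longrightarrow> T (s x) = x" and "B \<in> sets M"
  shows "partial_borel_injection M E (B \<inter> A) s"
  unfolding partial_borel_injection_def
proof (intro conjI ballI)
  show "B \<inter> A \<in> sets M" using assms by auto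
  have "s \<in> measurable (restrict_space (restrict_space M A) (B \<inter> A)) M"
    by (rule measurable_restrict_space1) fact
  then show "s \<in> measurable (restrict_space M (B \<inter> A)) M"
    by (simp add: restrict_restrict_space assms Int_absorb1 sets.Int Int_assoc[symmetric] Int_commute)
  show "inj_on s (B \<inter> A)"
    by (rule inj_on_inverseI[of _ T]) (use assms in auto)
  fix x assume "x \<in> B \<inter> A"
  moreover have "s x \<in> space M"
    using measurable_space[OF assms(2), of x] calculation sets.sets_into_space[OF assms(1)]
    by (auto simp: space_restrict_space)
  ultimately show "(x, s x) \<in> E"
    using E_preimage[of "s x"] assms(3) by auto
qed

text \<open>A measurable section of \<open>T\<close> over the null set is a partial injection onto a null set, so by
null preservation its domain, which is almost all of the image, is null.\<close>
lemma null_image_T: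
  assumes "N \<in> null_sets M"
  shows "\<exists>N'\<in>null_sets M. T ` N \<subseteq> N'"
proof -
  obtain A s Z where A: "A \<in> sets M" "s \<in> measurable (restrict_space M A) M"
    "\<And>x. x \<in> A \<Longrightarrow> s x \<in> N \<and> T (s x) = x" "Z \<in> null_sets M" "T ` N \<subseteq> A \<union> Z"
    using measurable_section[OF standard_borel finite_measure_axioms T_measurable, of N] assms
    by (metis null_setsD2)
  have pbi: "partial_borel_injection M E A s"
    using section_partial_injection[of A s A] A by simp
  have "s ` A \<in> null_sets M"
    using image_partial_injection_measurable[OF pbi] A(3)
    by (intro null_sets_subset[OF assms]) auto
  then have "A \<in> null_sets M"
    using null_preserving pbi unfolding null_preserving_def by blast
  then show ?thesis
    using A by (intro bexI[of _ "A \<union> Z"]) auto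
qed

text \<open>An almost sure property can be assumed along whole backward orbits. The exceptional null set is
enlarged until it is closed under \<open>T\<close>, so that its complement is closed under preimages.\<close>
lemma AE_backward:
  assumes "AE x in M. P x"
  obtains G where "AE x in M. x \<in> G" "G \<subseteq> space M" "\<And>x. x \<in> G \<Longrightarrow> P x"
    "\<And>y. y \<in> space M \<Longrightarrow> T y \<in> G \<Longrightarrow> y \<in> G"
proof -
  obtain N0 where N0: "N0 \<in> null_sets M" "{x \<in> space M. \<not> P x} \<subseteq> N0"
    using assms by (auto elim!: AE_E3)
  obtain F where F: "\<And>N. N \<in> null_sets M \<Longrightarrow> F N \<in> null_sets M \<and> T ` N \<subseteq> F N"
    using null_image_T by metis
  define N where "N k = (F ^^ k) N0" for k :: nat
  have N: "N k \<in> null_sets M" for k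
    by (induction k) (auto simp: N_def N0 F)
  have TN: "T ` N k \<subseteq> N (Suc k)" for k
    using F[OF N[of k]] by (simp add: N_def)
  have null: "(\<Union>k. N k) \<in> null_sets M"
    using N by auto
  show thesis
  proof (rule that[of "space M - (\<Union>k. N k)"])
    show "AE x in M. x \<in> space M - (\<Union>k. N k)"
      using AE_not_in[OF null] by (auto intro: AE_mp)
    show "P x" if "x \<in> space M - (\<Union>k. N k)" for x
      using that N0(2) N_def[of 0] by auto
    show "y \<in> space M - (\<Union>k. N k)" if "y \<in> space M" "T y \<in> space M - (\<Union>k. N k)" for y
      using that TN by blast
  qed auto
qed

section \<open>The transfer operator\<close>

text \<open>The Perron--Frobenius operator of \<open>T\<close>, the adjoint of composition with \<open>T\<close>. As a Radon--Nikodym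
derivative it is measurable by construction. The cocycle enters through the fact that over almost
every point \<open>transfer h\<close> dominates the sums of \<open>h\<close> over the fibre with weights \<open>\<rho>\<close>.\<close>
definition transfer :: "('a \<Rightarrow> real) \<Rightarrow> 'a \<Rightarrow> real" where
  "transfer h x = enn2real (RN_deriv M (distr (density M (\<lambda>x. ennreal (h x))) M T) x)"

lemma transfer_nonneg: "0 \<le> transfer h x"
  by (simp add: transfer_def)

lemma
  fixes h :: "'a \<Rightarrow> real"
  assumes h: "integrable M h" "\<And>x. 0 \<le> h x"
  shows transfer_integrable: "integrable M (transfer h)"
    and transfer_set_integral:
      "A \<in> sets M \<Longrightarrow> (LINT x:A|M. transfer h x) = (LINT x:T -` A \<inter> space M|M. h x)"
proof -
  have h_meas[measurable]: "h \<in> borel_measurable M"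
    using h(1) by auto
  define N where "N = distr (density M (\<lambda>x. ennreal (h x))) M T"
  have N_eq: "emeasure N A = (\<integral>\<^sup>+x. ennreal (h x * indicator (T -` A \<inter> space M) x) \<partial>M)"
    if [measurable]: "A \<in> sets M" for A
  proof -
    have "emeasure N A = emeasure (density M (\<lambda>x. ennreal (h x))) (T -` A \<inter> space M)"
      unfolding N_def by (subst emeasure_distr) auto
    also have "\<dots> = (\<integral>\<^sup>+x. ennreal (h x) * indicator (T -` A \<inter> space M) x \<partial>M)"
      by (intro emeasure_density) auto
    also have "\<dots> = (\<integral>\<^sup>+x. ennreal (h x * indicator (T -` A \<inter> space M) x) \<partial>M)"
      by (intro nn_integral_cong) (auto simp: indicator_def)
    finally show ?thesis .
  qed
  have int_h: "integrable M (\<lambda>x. h x * indicator (T -` A \<inter> space M) x)" if "A \<in> sets M" for A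
    using integrable_mult_indicator[of "T -` A \<inter> space M" M h] h(1) that
    by (auto simp: mult.commute)
  have N_eq': "emeasure N A = ennreal (LINT x:T -` A \<inter> space M|M. h x)" if "A \<in> sets M" for A
    unfolding N_eq[OF that] set_lebesgue_integral_def
    by (subst nn_integral_eq_integral[OF int_h[OF that]])
      (auto simp: h(2) mult.commute)
  have "absolutely_continuous M N"
    unfolding absolutely_continuous_def
  proof
    fix A assume A: "A \<in> null_sets M"
    then have "AE x in M. T x \<notin> A"
      by (intro AE_T AE_not_in)
    then have "emeasure N A = (\<integral>\<^sup>+x. 0 \<partial>M)"
      unfolding N_eq[OF null_setsD2[OF A]]
      by (intro nn_integral_cong_AE) (auto elim!: eventually_mono)
    then show "A \<in> null_sets N"
      using A by (auto simp: null_sets_def N_def)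
  qed
  then have dens: "density M (RN_deriv M N) = N"
    by (rule density_RN_deriv) (simp add: N_def)
  have RN_meas[measurable]: "RN_deriv M N \<in> borel_measurable M"
    by simp
  have RN_int: "(\<integral>\<^sup>+x. RN_deriv M N x * indicator A x \<partial>M) = ennreal (LINT x:T -` A \<inter> space M|M. h x)"
    if "A \<in> sets M" for A
    using that by (subst emeasure_density[symmetric]) (auto simp: dens N_eq')
  have "(\<integral>\<^sup>+x. RN_deriv M N x \<partial>M) = (\<integral>\<^sup>+x. RN_deriv M N x * indicator (space M) x \<partial>M)"
    by (intro nn_integral_cong) simp
  also have "\<dots> = ennreal (LINT x:T -` space M \<inter> space M|M. h x)"
    by (rule RN_int) simp
  finally have fin: "(\<integral>\<^sup>+x. RN_deriv M N x \<partial>M) = \<dots>" .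
  then have "AE x in M. RN_deriv M N x \<noteq> \<infinity>"
    by (intro nn_integral_PInf_AE) auto
  then have eq: "AE x in M. ennreal (transfer h x) = RN_deriv M N x"
    by eventually_elim (auto simp: transfer_def N_def[symmetric] less_top)
  have tr_meas[measurable]: "transfer h \<in> borel_measurable M"
    unfolding transfer_def N_def[symmetric] by measurable
  show int: "integrable M (transfer h)"
  proof (rule integrableI_nn_integral_finite)
    show "(\<integral>\<^sup>+x. ennreal (transfer h x) \<partial>M) = ennreal (LINT x:T -` space M \<inter> space M|M. h x)"
      unfolding fin[symmetric] by (rule nn_integral_cong_AE) (rule eq)
  qed (auto simp: transfer_nonneg)
  show "(LINT x:A|M. transfer h x) = (LINT x:T -` A \<inter> space M|M. h x)" if A: "A \<in> sets M"
  proof -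
    have "ennreal (LINT x:A|M. transfer h x) = (\<integral>\<^sup>+x. ennreal (indicator A x *\<^sub>R transfer h x) \<partial>M)"
      unfolding set_lebesgue_integral_def
      by (rule nn_integral_eq_integral[symmetric, OF integrable_mult_indicator[OF A int]])
        (simp add: transfer_nonneg)
    also have "\<dots> = (\<integral>\<^sup>+x. RN_deriv M N x * indicator A x \<partial>M)"
      by (intro nn_integral_cong_AE) (use eq in eventually_elim, auto simp: indicator_def)
    also have "\<dots> = ennreal (LINT x:T -` A \<inter> space M|M. h x)"
      by (rule RN_int[OF A])
    finally show ?thesis
      by (subst (asm) ennreal_inj)
        (auto simp: set_lebesgue_integral_def transfer_nonneg h(2) intro!: integral_nonneg_AE)
  qed
qed

lemma transfer_mono:
  fixes h h' :: "'a \<Rightarrow> real"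
  assumes "integrable M h" "\<And>x. 0 \<le> h x" "integrable M h'" "\<And>x. 0 \<le> h' x"
    and le: "AE x in M. h x \<le> h' x"
  shows "AE x in M. transfer h x \<le> transfer h' x"
proof (rule AE_le_if_set_integrals_le)
  fix A assume A: "A \<in> sets M"
  then have A': "T -` A \<inter> space M \<in> sets M" by simp
  have "(LINT x:T -` A \<inter> space M|M. h x) \<le> (LINT x:T -` A \<inter> space M|M. h' x)"
    unfolding set_lebesgue_integral_def
    by (intro integral_mono_AE integrable_mult_indicator A' assms)
      (use le in eventually_elim, auto simp: indicator_def)
  then show "(LINT x:A|M. transfer h x) \<le> (LINT x:A|M. transfer h' x)"
    using transfer_set_integral A assms by simp
qed (use transfer_integrable assms in auto)

text \<open>The images of inverse branches with values in disjoint sets are disjoint, and over a set \<open>B\<close> they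
lie in the preimage of \<open>B\<close>. Changing variables along each branch therefore bounds the integral over
\<open>B\<close> of the left-hand side by the integral of \<open>h\<close> over the preimage, for every \<open>B\<close>.\<close>
lemma sections_le_transfer:
  fixes h :: "'a \<Rightarrow> real"
  assumes h: "integrable M h" "\<And>x. 0 \<le> h x" and "finite J"
    and disj: "disjoint_family_on D J"
    and A: "\<And>j. j \<in> J \<Longrightarrow> A j \<in> sets M"
    and s: "\<And>j. j \<in> J \<Longrightarrow> s j \<in> measurable (restrict_space M (A j)) M"
    and sT: "\<And>j x. j \<in> J \<Longrightarrow> x \<in> A j \<Longrightarrow> s j x \<in> D j \<and> T (s j x) = x"
  shows "AE x in M. (\<Sum>j\<in>J. indicator (A j) x * (h (s j x) * \<rho> x (s j x))) \<le> transfer h x"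
proof (rule AE_le_if_set_integrals_le)
  have pbi: "partial_borel_injection M E (B \<inter> A j) (s j)" if "j \<in> J" "B \<in> sets M" for j B
    using section_partial_injection[OF A[OF that(1)] s[OF that(1)] _ that(2)] sT[OF that(1)] by auto
  have int: "integrable M (\<lambda>x. indicator (A j) x * (h (s j x) * \<rho> x (s j x)))" if "j \<in> J" for j
    using change_of_variables(1)[OF h(1) pbi[OF that A[OF that]]] by (simp add: set_integrable_def)
  then show "integrable M (\<lambda>x. \<Sum>j\<in>J. indicator (A j) x * (h (s j x) * \<rho> x (s j x)))"
    by (rule Bochner_Integration.integrable_sum)
  show "integrable M (transfer h)"
    by (rule transfer_integrable[OF h])
  fix B assume B: "B \<in> sets M"
  define I where "I j = s j ` (B \<inter> A j)" for j
  have I: "I j \<in> sets M" if "j \<in> J" for j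
    unfolding I_def by (rule image_partial_injection_measurable[OF pbi[OF that B]])
  have I_sub: "I j \<subseteq> T -` B \<inter> space M" if "j \<in> J" for j
    using sT[OF that] sets.sets_into_space[OF I[OF that]] by (auto simp: I_def)
  have I_disj: "disjoint_family_on I J"
    unfolding disjoint_family_on_def
  proof (intro ballI impI)
    fix i j assume "i \<in> J" "j \<in> J" "i \<noteq> j"
    moreover have "I i \<subseteq> D i" "I j \<subseteq> D j"
      using sT[OF \<open>i \<in> J\<close>] sT[OF \<open>j \<in> J\<close>] by (auto simp: I_def)
    ultimately show "I i \<inter> I j = {}"
      using disjoint_family_onD[OF disj] by blast
  qed
  have int_ind: "integrable M (\<lambda>x. indicator C x * h x)" if "C \<in> sets M" for C
    using integrable_mult_indicator[OF that h(1)] by simp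
  have "(LINT x:B|M. (\<Sum>j\<in>J. indicator (A j) x * (h (s j x) * \<rho> x (s j x)))) =
      (\<integral>x. (\<Sum>j\<in>J. indicator (B \<inter> A j) x * (h (s j x) * \<rho> x (s j x))) \<partial>M)"
    unfolding set_lebesgue_integral_def
    by (intro Bochner_Integration.integral_cong) (auto simp: sum_distrib_left indicator_inter_arith mult.assoc)
  also have "\<dots> = (\<Sum>j\<in>J. LINT x:B \<inter> A j|M. h (s j x) * \<rho> x (s j x))"
    unfolding set_lebesgue_integral_def
    using change_of_variables(1)[OF h(1) pbi[OF _ B]]
    by (subst Bochner_Integration.integral_sum) (auto simp: set_integrable_def)
  also have "\<dots> = (\<Sum>j\<in>J. LINT x:I j|M. h x)"
    unfolding I_def using change_of_variables(2)[OF h(1) pbi[OF _ B]] by simp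
  also have "\<dots> = (LINT x:(\<Union>j\<in>J. I j)|M. h x)"
    using I_disj I int_ind \<open>finite J\<close>
    by (intro set_integral_finite_Union[symmetric]) (auto simp: set_integrable_def)
  also have "\<dots> \<le> (LINT x:T -` B \<inter> space M|M. h x)"
    unfolding set_lebesgue_integral_def real_scaleR_def
  proof (intro integral_mono int_ind)
    show "(\<Union>j\<in>J. I j) \<in> sets M" using I \<open>finite J\<close> by auto
    show "T -` B \<inter> space M \<in> sets M" using B by simp
    show "indicator (\<Union>j\<in>J. I j) x * h x \<le> indicator (T -` B \<inter> space M) x * h x" for x
      using I_sub h(2)[of x] by (auto simp: indicator_def)
  qed
  also have "\<dots> = (LINT x:B|M. transfer h x)"
    by (rule transfer_set_integral[OF h B, symmetric])
  finally show "(LINT x:B|M. (\<Sum>j\<in>J. indicator (A j) x * (h (s j x) * \<rho> x (s j x))))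
      \<le> (LINT x:B|M. transfer h x)" .
qed

text \<open>For each \<open>k\<close> the space is cut into countably many cells on which the first coordinates of an
injective sequence of functions \<open>v\<close> agree up to \<open>2 ^ -k\<close>. Each cell has a measurable section of \<open>T\<close>,
and at a point of a fibre the summand differs from its value at the section of its cell by at most
\<open>2 ^ -k\<close>, because the summand is the coordinate \<open>v y 0\<close>. A finite subset of a fibre is separated by
the cells as soon as \<open>k\<close> is large, so its sum exceeds a sum over disjoint sections by at most
\<open>card F * 2 ^ -k\<close>.\<close>
lemma finite_fibre_sum_le_transfer:
  fixes h :: "'a \<Rightarrow> real"
  assumes h: "integrable M h" "\<And>x. 0 \<le> h x"
  shows "AE x in M. \<forall>F. finite F \<longrightarrow> F \<subseteq> T -` {x} \<inter> space M \<longrightarrow>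
    (\<Sum>y\<in>F. h y * \<rho> x y) \<le> transfer h x"
proof -
  have [measurable]: "h \<in> borel_measurable M"
    using h(1) by auto
  obtain e :: "'a \<Rightarrow> nat \<Rightarrow> real" where e: "inj_on e (space M)" "e \<in> borel_measurable M"
    using standard_borel_embedding[OF standard_borel] not_empty by blast
  have e_meas[measurable]: "(\<lambda>x. e x i) \<in> borel_measurable M" for i
    using measurable_compose[OF e(2) measurable_product_coordinates] by simp
  define v where "v y i = (case i of 0 \<Rightarrow> h y * \<rho> (T y) y | Suc j \<Rightarrow> e y j)" for y i
  have v_meas[measurable]: "(\<lambda>y. v y i) \<in> borel_measurable M" for i
    unfolding v_def by (cases i) auto
  define \<kappa> where "\<kappa> k y = map (\<lambda>i. \<lfloor>2 ^ k * v y i\<rfloor>) [0..<Suc k]" for k y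
  define D where "D k c = {y \<in> space M. \<kappa> k y = c}" for k c
  have D_eq: "D k c = {y \<in> space M. length c = Suc k \<and> (\<forall>i<Suc k. \<lfloor>2 ^ k * v y i\<rfloor> = c ! i)}" for k c
    unfolding D_def \<kappa>_def list_eq_iff_nth_eq by (auto simp del: upt_Suc)
  have D_meas: "D k c \<in> sets M" for k c
    unfolding D_eq by measurable
  have "\<forall>k c. \<exists>A s Z. A \<in> sets M \<and> s \<in> measurable (restrict_space M A) M \<and>
    (\<forall>x\<in>A. s x \<in> D k c \<and> T (s x) = x) \<and> Z \<in> null_sets M \<and> T ` D k c \<subseteq> A \<union> Z"
  proof (intro allI)
    fix k c
    obtain A s Z where "A \<in> sets M" "s \<in> measurable (restrict_space M A) M"
      "\<And>x. x \<in> A \<Longrightarrow> s x \<in> D k c \<and> T (s x) = x" "Z \<in> null_sets M" "T ` D k c \<subseteq> A \<union> Z"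
      using measurable_section[OF standard_borel finite_measure_axioms T_measurable D_meas[of k c]]
      by blast
    then show "\<exists>A s Z. A \<in> sets M \<and> s \<in> measurable (restrict_space M A) M \<and>
      (\<forall>x\<in>A. s x \<in> D k c \<and> T (s x) = x) \<and> Z \<in> null_sets M \<and> T ` D k c \<subseteq> A \<union> Z"
      by blast
  qed
  then obtain A s Z where A: "\<And>k c. A k c \<in> sets M"
    and s: "\<And>k c. s k c \<in> measurable (restrict_space M (A k c)) M"
    and sT: "\<And>k c x. x \<in> A k c \<Longrightarrow> s k c x \<in> D k c \<and> T (s k c x) = x"
    and Z: "\<And>k c. Z k c \<in> null_sets M" and TD: "\<And>k c. T ` D k c \<subseteq> A k c \<union> Z k c"
    by metis
  have "AE x in M. \<forall>k. \<forall>J\<in>{J. finite J}. (\<Sum>c\<in>J. indicator (A k c) x * (h (s k c x) * \<rho> x (s k c x))) \<le> transfer h x"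
    unfolding AE_all_countable
  proof (intro allI AE_ball_countable[THEN iffD2] ballI)
    show "countable {J :: int list set. finite J}"
      using countable_Collect_finite by simp
    fix k and J :: "int list set" assume "J \<in> {J. finite J}"
    then show "AE x in M. (\<Sum>c\<in>J. indicator (A k c) x * (h (s k c x) * \<rho> x (s k c x))) \<le> transfer h x"
      using sT by (intro sections_le_transfer[OF h, of J "D k"] A s)
        (auto simp: disjoint_family_on_def D_def)
  qed
  moreover have "AE x in M. \<forall>k c. x \<notin> Z k c"
    using Z by (auto simp: AE_all_countable intro: AE_not_in)
  ultimately show ?thesis
  proof eventually_elim
    case (elim x)
    show ?case
    proof (intro allI impI)
      fix F assume F: "finite F" "F \<subseteq> T -` {x} \<inter> space M"
      have bound: "(\<Sum>y\<in>F. h y * \<rho> x y) \<le> transfer h x + card F * (1/2) ^ k" if inj: "inj_on (\<kappa> k) F" for k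
      proof -
        have "h y * \<rho> x y \<le> indicator (A k (\<kappa> k y)) x * (h (s k (\<kappa> k y) x) * \<rho> x (s k (\<kappa> k y) x)) + (1/2) ^ k"
          if y: "y \<in> F" for y
        proof -
          let ?c = "\<kappa> k y"
          have yD: "y \<in> D k ?c" "T y = x"
            using y F by (auto simp: D_def)
          then have xA: "x \<in> A k ?c"
            using elim(2) TD[of k ?c] by blast
          define w where "w = s k ?c x"
          have w: "w \<in> D k ?c" "T w = x"
            using sT[OF xA] by (auto simp: w_def)
          then have "\<kappa> k w ! 0 = \<kappa> k y ! 0"
            by (simp add: D_def)
          then have "\<lfloor>2 ^ k * v w 0\<rfloor> = \<lfloor>2 ^ k * v y 0\<rfloor>"
            by (simp add: \<kappa>_def del: upt_Suc)
          then have "2 ^ k * v y 0 \<le> 2 ^ k * v w 0 + 1"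
            by linarith
          then have "v y 0 \<le> v w 0 + (1/2) ^ k"
            by (simp add: field_simps power_divide)
          then show ?thesis
            using yD w xA by (simp add: v_def w_def[symmetric])
        qed
        then have "(\<Sum>y\<in>F. h y * \<rho> x y) \<le>
            (\<Sum>y\<in>F. indicator (A k (\<kappa> k y)) x * (h (s k (\<kappa> k y) x) * \<rho> x (s k (\<kappa> k y) x)) + (1/2) ^ k)"
          by (rule sum_mono)
        also have "\<dots> = (\<Sum>c\<in>\<kappa> k ` F. indicator (A k c) x * (h (s k c x) * \<rho> x (s k c x))) + card F * (1/2) ^ k"
          by (simp add: sum.distrib sum.reindex[OF inj])
        also have "\<dots> \<le> transfer h x + card F * (1/2) ^ k"
          using elim(1) F(1) by simp
        finally show ?thesis .
      qed
      have "\<forall>\<^sub>F k in sequentially. \<forall>y\<in>F. \<forall>y'\<in>F. y \<noteq> y' \<longrightarrow> \<kappa> k y \<noteq> \<kappa> k y'"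
      proof (intro eventually_ball_finite F ballI)
        fix y y' assume yy: "y \<in> F" "y' \<in> F"
        show "\<forall>\<^sub>F k in sequentially. y \<noteq> y' \<longrightarrow> \<kappa> k y \<noteq> \<kappa> k y'"
        proof (cases "y = y'")
          case False
          then have "e y \<noteq> e y'"
            using e(1) yy F by (auto simp: inj_on_def)
          then obtain j where "e y j \<noteq> e y' j" by blast
          then have j: "\<bar>v y (Suc j) - v y' (Suc j)\<bar> > 0"
            by (simp add: v_def)
          obtain n where n: "(1/2) ^ n < \<bar>v y (Suc j) - v y' (Suc j)\<bar>"
            using real_arch_pow_inv[OF j, of "1/2"] by auto
          have "\<kappa> k y \<noteq> \<kappa> k y'" if k: "k \<ge> max n (Suc j)" for k
          proof
            assume "\<kappa> k y = \<kappa> k y'"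
            then have "\<kappa> k y ! Suc j = \<kappa> k y' ! Suc j" by simp
            then have "\<lfloor>2 ^ k * v y (Suc j)\<rfloor> = \<lfloor>2 ^ k * v y' (Suc j)\<rfloor>"
              using k by (simp add: \<kappa>_def del: upt_Suc)
            then have "\<bar>2 ^ k * v y (Suc j) - 2 ^ k * v y' (Suc j)\<bar> \<le> 1"
              by linarith
            then have "2 ^ k * \<bar>v y (Suc j) - v y' (Suc j)\<bar> \<le> 1"
              by (simp add: abs_mult flip: right_diff_distrib)
            then have "\<bar>v y (Suc j) - v y' (Suc j)\<bar> \<le> (1/2) ^ k"
              by (simp add: field_simps power_divide)
            also have "\<dots> \<le> (1/2) ^ n"
              using k by (intro power_decreasing) auto
            finally show False using n by simp
          qed
          then show ?thesis
            unfolding eventually_sequentially by blast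
        qed simp
      qed
      then have "\<forall>\<^sub>F k in sequentially. (\<Sum>y\<in>F. h y * \<rho> x y) \<le> transfer h x + card F * (1/2) ^ k"
        by eventually_elim (intro bound inj_onI, blast)
      moreover have "(\<lambda>k. transfer h x + card F * (1/2) ^ k) \<longlonglongrightarrow> transfer h x + real (card F) * 0"
        by (rule tendsto_add[OF tendsto_const tendsto_mult[OF tendsto_const LIMSEQ_power_zero]]) simp
      ultimately show "(\<Sum>y\<in>F. h y * \<rho> x y) \<le> transfer h x"
        using tendsto_lowerbound by fastforce
    qed
  qed
qed

section \<open>Trees and the maximal inequality\<close>

text \<open>Aperiodicity is what makes the graph of \<open>T\<close> a forest, so that a point of a tree has a well-defined
height above the root.\<close>
lemma level_unique:
  assumes "y \<in> space M" "(T ^^ i) y = (T ^^ j) y"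
  shows "i = j"
proof -
  have "\<not> i < j" if eq: "(T ^^ i) y = (T ^^ j) y" for i j
  proof
    assume "i < j"
    then have "(T ^^ (j - i)) ((T ^^ i) y) = (T ^^ i) y"
      using eq funpow_add[of "j - i" i T] by simp
    moreover have "1 \<le> j - i" "(T ^^ i) y \<in> space M"
      using \<open>i < j\<close> assms(1) by auto
    ultimately show False
      using aperiodic unfolding aperiodic_map_def by blast
  qed
  from this[OF assms(2)] this[OF assms(2)[symmetric]] show ?thesis
    by linarith
qed

text \<open>Almost everywhere a measurable upper bound for the supremum of the weighted sums of \<open>g\<close> over trees of height at most
\<open>n\<close>. An optimal tree of height \<open>Suc n\<close> consists of its root and, above each preimage of the root,
of an optimal tree of height \<open>n\<close> or of nothing at all, whichever is better.\<close>
primrec tree_bound :: "('a \<Rightarrow> real) \<Rightarrow> nat \<Rightarrow> 'a \<Rightarrow> real" where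
  "tree_bound g 0 = g"
| "tree_bound g (Suc n) = (\<lambda>x. g x + transfer (\<lambda>y. max 0 (tree_bound g n y)) x)"

lemma tree_bound_integrable:
  assumes "integrable M g"
  shows "integrable M (tree_bound g n)"
proof (induction n)
  case (Suc n)
  then have "integrable M (transfer (\<lambda>y. max 0 (tree_bound g n y)))"
    by (intro transfer_integrable) auto
  with assms show ?case by simp
qed (simp add: assms)

lemma tree_bound_mono:
  assumes "integrable M g"
  shows "AE x in M. tree_bound g n x \<le> tree_bound g (Suc n) x"
proof (induction n)
  case 0
  show ?case by (simp add: transfer_nonneg)
next
  case (Suc n)
  have "AE x in M. transfer (\<lambda>y. max 0 (tree_bound g n y)) x \<le> transfer (\<lambda>y. max 0 (tree_bound g (Suc n) y)) x"
    using Suc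
    by (intro transfer_mono integrable_max integrable_zero tree_bound_integrable assms)
      (auto elim!: eventually_mono simp del: tree_bound.simps)
  then show ?case by simp
qed

text \<open>Removing the root \<open>x\<close> leaves disjoint trees \<open>S z\<close> of smaller height over the children \<open>z\<close> of the root.
The cocycle identity \<open>\<rho> x y = \<rho> x z * \<rho> z y\<close> turns weights seen from the root into weights seen
from the child, and the sum over the children is a sum over a finite part of one fibre. The set \<open>G\<close>
contains all points at which the fibre inequality is applied.\<close>
lemma tree_sum_le_tree_bound:
  assumes G: "G \<subseteq> space M" "\<And>y. y \<in> space M \<Longrightarrow> T y \<in> G \<Longrightarrow> y \<in> G"
    and fibre: "\<And>x n F. x \<in> G \<Longrightarrow> finite F \<Longrightarrow> F \<subseteq> T -` {x} \<inter> space M \<Longrightarrow>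
      (\<Sum>y\<in>F. max 0 (tree_bound g n y) * \<rho> x y) \<le> transfer (\<lambda>y. max 0 (tree_bound g n y)) x"
    and "x \<in> G" "finite F" "F \<in> rooted_trees (space M) T x"
    and "F \<subseteq> (\<Union>i\<le>n. (T ^^ i) -` {x} \<inter> space M)"
  shows "(\<Sum>y\<in>F. g y * \<rho> x y) \<le> tree_bound g n x"
  using assms(4-)
proof (induction n arbitrary: x F)
  case 0
  then have "F = {x}" "x \<in> space M"
    using G by (auto simp: rooted_trees_def)
  then show ?case
    by (simp add: rho_refl)
next
  case (Suc n)
  have xF: "x \<in> F" and up: "\<And>y. y \<in> F \<Longrightarrow> y \<noteq> x \<Longrightarrow> T y \<in> F" and x: "x \<in> space M"
    and Fsp: "F \<subseteq> space M"
    using Suc.prems G(1) by (auto simp: rooted_trees_def)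
  define Z where "Z = F \<inter> T -` {x}"
  define S where "S z = {y \<in> F. \<exists>i. (T ^^ i) y = z}" for z
  have lev: "\<exists>j\<le>Suc n. (T ^^ j) y = x" if "y \<in> F" for y
    using Suc.prems(4) that by auto
  have SZ: "\<exists>i. (T ^^ i) y = z \<and> (T ^^ Suc i) y = x" if "z \<in> Z" "y \<in> S z" for y z
    using that by (auto simp: S_def Z_def)
  have disj: "S z \<inter> S z' = {}" if zz: "z \<in> Z" "z' \<in> Z" "z \<noteq> z'" for z z'
  proof (rule ccontr)
    assume "S z \<inter> S z' \<noteq> {}"
    then obtain y where y: "y \<in> S z" "y \<in> S z'" by blast
    obtain i where i: "(T ^^ i) y = z" "(T ^^ Suc i) y = x"
      using SZ[OF zz(1) y(1)] by blast
    obtain j where j: "(T ^^ j) y = z'" "(T ^^ Suc j) y = x"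
      using SZ[OF zz(2) y(2)] by blast
    have "y \<in> space M"
      using y Fsp by (auto simp: S_def)
    then have "Suc i = Suc j"
      using i(2) j(2) by (intro level_unique[of y]) simp_all
    with i j zz show False by simp
  qed
  have x_notin: "x \<notin> S z" if z: "z \<in> Z" for z
  proof
    assume "x \<in> S z"
    then obtain i where "(T ^^ Suc i) x = x"
      using SZ[OF z] by blast
    then have "Suc i = 0"
      by (intro level_unique[OF x]) simp
    then show False by simp
  qed
  have path: "(T ^^ j) y \<in> F" if y: "y \<in> F" "(T ^^ i) y = x" and "j \<le> i" for i j y
    using \<open>j \<le> i\<close>
  proof (induction j)
    case (Suc j)
    have "(T ^^ j) y \<noteq> x"
    proof
      assume "(T ^^ j) y = x"
      then have "j = i"
        using y Fsp by (intro level_unique[of y]) auto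
      with Suc show False by simp
    qed
    with Suc up show ?case by simp
  qed (simp add: y)
  have "F \<subseteq> insert x (\<Union>z\<in>Z. S z)"
  proof
    fix y assume y: "y \<in> F"
    then obtain j where j: "(T ^^ j) y = x"
      using lev by blast
    show "y \<in> insert x (\<Union>z\<in>Z. S z)"
    proof (cases j)
      case (Suc i)
      have "(T ^^ i) y \<in> F"
        using Suc by (intro path[OF y j]) auto
      then have "(T ^^ i) y \<in> Z" "y \<in> S ((T ^^ i) y)"
        using j Suc y by (auto simp: Z_def S_def)
      then show ?thesis by blast
    qed (use j in simp)
  qed
  then have F_eq: "F = insert x (\<Union>z\<in>Z. S z)"
    using xF by (auto simp: S_def)
  have finZ: "finite Z" "\<And>z. finite (S z)"
    using Suc.prems(2) by (auto simp: Z_def S_def)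
  have branch: "(\<Sum>y\<in>S z. g y * \<rho> x y) \<le> max 0 (tree_bound g n z) * \<rho> x z" if z: "z \<in> Z" for z
  proof -
    have zsp: "z \<in> space M" "T z = x" "z \<in> F"
      using z Fsp by (auto simp: Z_def)
    then have xz: "(x, z) \<in> E"
      using E_preimage[of z] by simp
    have "(\<Sum>y\<in>S z. g y * \<rho> x y) = \<rho> x z * (\<Sum>y\<in>S z. g y * \<rho> z y)"
      unfolding sum_distrib_left
    proof (intro sum.cong refl)
      fix y assume y: "y \<in> S z"
      then obtain i where "(T ^^ i) y = z" by (auto simp: S_def)
      then have "(z, y) \<in> E"
        using zsp y Fsp by (intro orbit_relI[of z y 0 i]) (auto simp: S_def)
      then show "g y * \<rho> x y = \<rho> x z * (g y * \<rho> z y)"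
        using rho_mult[OF xz] by (simp add: mult.commute mult.left_commute)
    qed
    also have "(\<Sum>y\<in>S z. g y * \<rho> z y) \<le> tree_bound g n z"
    proof (rule Suc.IH)
      show "z \<in> G"
        using G(2) zsp Suc.prems(1) by blast
      show "finite (S z)" by (rule finZ)
      show sub: "S z \<subseteq> (\<Union>i\<le>n. (T ^^ i) -` {z} \<inter> space M)"
      proof
        fix y assume y: "y \<in> S z"
        then obtain i where i: "(T ^^ i) y = z" "(T ^^ Suc i) y = x"
          using SZ[OF z] by blast
        obtain j where j: "j \<le> Suc n" "(T ^^ j) y = x"
          using lev y by (auto simp: S_def)
        have "y \<in> space M" using y Fsp by (auto simp: S_def)
        moreover have "Suc i = j"
          using i j by (intro level_unique[OF \<open>y \<in> space M\<close>]) simp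
        ultimately show "y \<in> (\<Union>i\<le>n. (T ^^ i) -` {z} \<inter> space M)"
          using i j by auto
      qed
      have "z \<in> S z"
        using zsp by (auto simp: S_def intro: exI[of _ 0])
      moreover have "T y \<in> S z" if y: "y \<in> S z" "y \<noteq> z" for y
      proof -
        obtain i where i: "(T ^^ i) y = z"
          using y by (auto simp: S_def)
        with y obtain k where k: "i = Suc k" by (cases i) auto
        have "y \<noteq> x" using x_notin[OF z] y by auto
        then have "T y \<in> F" using y up by (auto simp: S_def)
        moreover have "(T ^^ k) (T y) = z"
          using i by (simp add: k funpow_swap1)
        ultimately show ?thesis by (auto simp: S_def)
      qed
      ultimately show "S z \<in> rooted_trees (space M) T z"
        using sub unfolding rooted_trees_def by blast
    qed
    then have "\<rho> x z * (\<Sum>y\<in>S z. g y * \<rho> z y) \<le> \<rho> x z * max 0 (tree_bound g n z)"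
      using rho_pos[OF xz] by (intro mult_left_mono) auto
    finally show ?thesis by (simp add: mult.commute)
  qed
  have "(\<Sum>y\<in>F. g y * \<rho> x y) = g x * \<rho> x x + (\<Sum>y\<in>(\<Union>z\<in>Z. S z). g y * \<rho> x y)"
    unfolding F_eq using finZ x_notin by (subst sum.insert) auto
  also have "(\<Sum>y\<in>(\<Union>z\<in>Z. S z). g y * \<rho> x y) = (\<Sum>z\<in>Z. \<Sum>y\<in>S z. g y * \<rho> x y)"
    using finZ disj by (intro sum.UNION_disjoint) auto
  also have "\<dots> \<le> (\<Sum>z\<in>Z. max 0 (tree_bound g n z) * \<rho> x z)"
    by (intro sum_mono branch)
  also have "\<dots> \<le> transfer (\<lambda>y. max 0 (tree_bound g n y)) x"
    using Fsp by (intro fibre Suc.prems finZ) (auto simp: Z_def)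
  finally show ?case
    by (simp add: rho_refl[OF x])
qed

text \<open>Garsia's proof of the maximal ergodic theorem in limit form. For almost every \<open>x\<close>, if the bounds
at \<open>x\<close> are unbounded in \<open>n\<close>, so are those at \<open>T x\<close>, because a tree at \<open>x\<close> becomes one at \<open>T x\<close> by adding the new
root; since \<open>T\<close> preserves the measure, the set where this happens agrees almost everywhere with an
invariant set \<open>A\<close>. The recursion and the duality between the transfer operator and \<open>T\<close> give
\<open>\<integral>\<^sub>A g = \<integral>\<^sub>A (b\<^sub>n\<^sub>+\<^sub>1 - max 0 b\<^sub>n) \<ge> \<integral>\<^sub>A min 0 b\<^sub>n\<^sub>+\<^sub>1\<close> for the bounds \<open>b\<^sub>n\<close>, which
increase with \<open>n\<close>, and the last integral tends to \<open>0\<close> because \<open>b\<^sub>n\<close> tends to infinity on \<open>A\<close>.\<close>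
lemma maximal_ergodic:
  assumes g: "integrable M g"
  obtains A where "A \<in> sets M" "T -` A \<inter> space M = A" "0 \<le> (LINT x:A|M. g x)"
    "AE x in M. x \<notin> A \<longrightarrow> bdd_above (range (\<lambda>n. tree_bound g n x))"
proof -
  note [measurable] = borel_measurable_integrable[OF tree_bound_integrable[OF g]]
  define U where "U x \<longleftrightarrow> \<not> bdd_above (range (\<lambda>n. tree_bound g n x))" for x
  have U_iff: "U x \<longleftrightarrow> (\<forall>C::nat. \<exists>n. real C < tree_bound g n x)" for x
  proof
    assume "U x"
    show "\<forall>C::nat. \<exists>n. real C < tree_bound g n x"
    proof (rule allI, rule ccontr)
      fix C :: nat assume "\<nexists>n. real C < tree_bound g n x"
      then have "bdd_above (range (\<lambda>n. tree_bound g n x))"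
        by (intro bdd_aboveI2[of _ _ "real C"]) (auto simp: not_less)
      with \<open>U x\<close> show False by (simp add: U_def)
    qed
  next
    assume *: "\<forall>C::nat. \<exists>n. real C < tree_bound g n x"
    show "U x"
      unfolding U_def
    proof
      assume "bdd_above (range (\<lambda>n. tree_bound g n x))"
      then obtain C where C: "\<And>n. tree_bound g n x \<le> C"
        by (auto simp: bdd_above_def)
      obtain n where "real (nat \<lceil>C\<rceil>) < tree_bound g n x" using * by blast
      with C[of n] show False by linarith
    qed
  qed
  have U_meas[measurable]: "Measurable.pred M U"
    unfolding U_iff by measurable
  have mono: "AE x in M. \<forall>n. tree_bound g n x \<le> tree_bound g (Suc n) x"
    using tree_bound_mono[OF g] by (auto simp: AE_all_countable simp del: tree_bound.simps)
  have "AE x in M. \<forall>n. \<forall>F. finite F \<longrightarrow> F \<subseteq> T -` {x} \<inter> space M \<longrightarrow>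
      (\<Sum>y\<in>F. max 0 (tree_bound g n y) * \<rho> x y) \<le> transfer (\<lambda>y. max 0 (tree_bound g n y)) x"
    unfolding AE_all_countable
    by (intro allI finite_fibre_sum_le_transfer integrable_max integrable_zero tree_bound_integrable g) simp
  from AE_T[OF this] have forward: "AE x in M. U x \<longrightarrow> U (T x)"
  proof (rule AE_mp[OF _ AE_I2], intro impI)
    fix x assume x: "x \<in> space M" and Ux: "U x"
    assume *: "\<forall>n. \<forall>F. finite F \<longrightarrow> F \<subseteq> T -` {T x} \<inter> space M \<longrightarrow>
      (\<Sum>y\<in>F. max 0 (tree_bound g n y) * \<rho> (T x) y) \<le> transfer (\<lambda>y. max 0 (tree_bound g n y)) (T x)"
    have step: "g (T x) + max 0 (tree_bound g n x) * \<rho> (T x) x \<le> tree_bound g (Suc n) (T x)" for n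
      using *[rule_format, of "{x}" n] x by simp
    have pos: "0 < \<rho> (T x) x"
      by (rule rho_pos[OF E_preimage[OF x]])
    show "U (T x)"
      unfolding U_def
    proof
      assume "bdd_above (range (\<lambda>n. tree_bound g n (T x)))"
      then obtain C where C: "\<And>n. tree_bound g n (T x) \<le> C"
        by (auto simp: bdd_above_def)
      have "tree_bound g n x \<le> (C - g (T x)) / \<rho> (T x) x" for n
      proof -
        have "max 0 (tree_bound g n x) * \<rho> (T x) x \<le> C - g (T x)"
          using step[of n] C[of "Suc n"] by linarith
        then have "max 0 (tree_bound g n x) \<le> (C - g (T x)) / \<rho> (T x) x"
          by (rule pos_le_divide_eq[OF pos, THEN iffD2])
        then show ?thesis by simp
      qed
      then have "bdd_above (range (\<lambda>n. tree_bound g n x))"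
        by (auto simp: bdd_above_def)
      with Ux show False by (simp add: U_def)
    qed
  qed
  have backward: "AE x in M. U (T x) \<longrightarrow> U x"
  proof -
    let ?B = "{x \<in> space M. U x}" and ?B' = "{x \<in> space M. U (T x)}"
    have [measurable]: "?B \<in> sets M" "?B' \<in> sets M"
      by measurable
    have "?B' = T -` ?B \<inter> space M" by auto
    then have "measure M ?B' = measure M ?B"
      using emeasure_vimage_T[of ?B] by (simp add: measure_def)
    moreover have "measure M (?B' \<inter> ?B) = measure M ?B"
      using forward by (intro measure_eq_AE) auto
    moreover have "measure M (?B' - ?B) = measure M ?B' - measure M (?B' \<inter> ?B)"
      by (rule finite_measure_Diff') auto
    ultimately have "?B' - ?B \<in> null_sets M"
      by (auto simp: null_sets_def emeasure_eq_measure)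
    then have "AE x in M. x \<notin> ?B' - ?B"
      by (rule AE_not_in)
    with AE_space show ?thesis
      by eventually_elim auto
  qed
  have "AE x in M. \<forall>n. U ((T ^^ n) (T x)) = U ((T ^^ n) x)"
    unfolding AE_all_countable
  proof
    fix n
    from forward backward have "AE x in M. U (T x) = U x"
      by eventually_elim auto
    from AE_funpow_T[OF this, of n] show "AE x in M. U ((T ^^ n) (T x)) = U ((T ^^ n) x)"
      by (simp add: funpow_swap1)
  qed
  then have orbit: "AE x in M. \<forall>n. U ((T ^^ n) x) = U x"
  proof eventually_elim
    case (elim x)
    show ?case
    proof
      show "U ((T ^^ n) x) = U x" for n
        by (induction n) (use elim in \<open>auto simp: funpow_swap1\<close>)
    qed
  qed
  \<comment> \<open>Asking that the orbit satisfies \<open>U\<close> infinitely often makes the set exactly invariant, not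
    only up to a null set.\<close>
  define A where "A = {x \<in> space M. \<forall>m. \<exists>n\<ge>m. U ((T ^^ n) x)}"
  have A[measurable]: "A \<in> sets M"
    unfolding A_def by measurable
  have A_inv: "T -` A \<inter> space M = A"
  proof -
    have "(\<forall>m. \<exists>n\<ge>m. U ((T ^^ n) (T x))) \<longleftrightarrow> (\<forall>m. \<exists>n\<ge>m. U ((T ^^ n) x))" for x
    proof safe
      fix m assume "\<forall>m. \<exists>n\<ge>m. U ((T ^^ n) (T x))"
      then obtain n where "n \<ge> m" "U ((T ^^ Suc n) x)"
        by (auto simp: funpow_swap1)
      then show "\<exists>n\<ge>m. U ((T ^^ n) x)"
        using le_SucI by blast
    next
      fix m assume "\<forall>m. \<exists>n\<ge>m. U ((T ^^ n) x)"
      then obtain n where "n \<ge> Suc m" "U ((T ^^ n) x)" by blast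
      then show "\<exists>n\<ge>m. U ((T ^^ n) (T x))"
        by (cases n) (auto simp: funpow_swap1)
    qed
    then show ?thesis by (auto simp: A_def)
  qed
  have AU: "AE x in M. x \<in> A \<longleftrightarrow> U x"
    using orbit AE_space by eventually_elim (auto simp: A_def)
  have int_A: "integrable M (\<lambda>x. indicator A x * h x)" if "integrable M h" for h :: "'a \<Rightarrow> real"
    using integrable_mult_indicator[OF A that] by simp
  have int_max: "integrable M (\<lambda>x. max 0 (tree_bound g n x))" and int_min: "integrable M (\<lambda>x. min 0 (tree_bound g n x))" for n
    by (auto intro!: integrable_max integrable_min tree_bound_integrable g)
  have lower: "(LINT x:A|M. min 0 (tree_bound g (Suc n) x)) \<le> (LINT x:A|M. g x)" for n
  proof -
    have "(LINT x:A|M. transfer (\<lambda>y. max 0 (tree_bound g n y)) x) = (LINT x:A|M. max 0 (tree_bound g n x))"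
      by (subst transfer_set_integral) (auto simp: int_max A_inv)
    then have "(LINT x:A|M. g x) = (LINT x:A|M. tree_bound g (Suc n) x) - (LINT x:A|M. max 0 (tree_bound g n x))"
      using int_A[OF g] int_A[OF transfer_integrable[OF int_max[of n]]]
      by (simp add: set_lebesgue_integral_def distrib_left)
    also have "\<dots> = (\<integral>x. indicator A x * tree_bound g (Suc n) x - indicator A x * max 0 (tree_bound g n x) \<partial>M)"
      unfolding set_lebesgue_integral_def real_scaleR_def
      by (rule Bochner_Integration.integral_diff[symmetric] int_A int_max tree_bound_integrable g)+
    also have "\<dots> \<ge> (LINT x:A|M. min 0 (tree_bound g (Suc n) x))"
      unfolding set_lebesgue_integral_def real_scaleR_def
    proof (rule integral_mono_AE)
      show "AE x in M. indicator A x * min 0 (tree_bound g (Suc n) x)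
          \<le> indicator A x * tree_bound g (Suc n) x - indicator A x * max 0 (tree_bound g n x)"
        using mono
      proof eventually_elim
        case (elim x)
        then have "tree_bound g n x \<le> tree_bound g (Suc n) x" by blast
        then have "min 0 (tree_bound g (Suc n) x) \<le> tree_bound g (Suc n) x - max 0 (tree_bound g n x)"
          by linarith
        then show ?case
          by (cases "x \<in> A") (simp_all del: tree_bound.simps)
      qed
    qed (intro int_A int_min int_max tree_bound_integrable g Bochner_Integration.integrable_diff)+
    finally show ?thesis .
  qed
  have "(\<lambda>n. \<integral>x. indicator A x * min 0 (tree_bound g (Suc n) x) \<partial>M) \<longlonglongrightarrow> (\<integral>x. 0 \<partial>M)"
  proof (rule integral_dominated_convergence[where w = "\<lambda>x. \<bar>g x\<bar>"])
    show "AE x in M. (\<lambda>n. indicator A x * min 0 (tree_bound g (Suc n) x)) \<longlonglongrightarrow> 0"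
      using AU mono
    proof eventually_elim
      case (elim x)
      show ?case
      proof (cases "x \<in> A")
        case True
        then obtain n where n: "0 < tree_bound g n x"
          using elim unfolding U_iff by (auto dest!: spec[of _ 0])
        have "incseq (\<lambda>n. tree_bound g n x)"
          using elim(2) by (intro incseq_SucI) blast
        then have "0 < tree_bound g (Suc m) x" if "m \<ge> n" for m
          using n that incseqD[of "\<lambda>n. tree_bound g n x" n "Suc m"] by linarith
        then have "\<forall>\<^sub>F m in sequentially. indicator A x * min 0 (tree_bound g (Suc m) x) = 0"
          unfolding eventually_sequentially by (intro exI[of _ n]) (auto simp del: tree_bound.simps)
        then show ?thesis
          by (rule tendsto_eventually)
      qed simp
    qed
    show "AE x in M. norm (indicator A x * min 0 (tree_bound g (Suc n) x)) \<le> \<bar>g x\<bar>" for n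
    proof (rule AE_I2)
      fix x
      have "g x \<le> tree_bound g (Suc n) x"
        by (simp add: transfer_nonneg)
      then show "norm (indicator A x * min 0 (tree_bound g (Suc n) x)) \<le> \<bar>g x\<bar>"
        by (auto simp: indicator_def simp del: tree_bound.simps)
    qed
    show "integrable M (\<lambda>x. \<bar>g x\<bar>)" using g by simp
  qed (measurable)
  then have "(\<lambda>n. LINT x:A|M. min 0 (tree_bound g (Suc n) x)) \<longlonglongrightarrow> 0"
    by (simp add: set_lebesgue_integral_def del: tree_bound.simps)
  then have "0 \<le> (LINT x:A|M. g x)"
    by (rule LIMSEQ_le_const2) (use lower in blast)
  moreover have "AE x in M. x \<notin> A \<longrightarrow> bdd_above (range (\<lambda>n. tree_bound g n x))"
    using AU by eventually_elim (auto simp: U_def)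
  ultimately show thesis
    using that A A_inv by blast
qed

section \<open>Convergence of tree averages\<close>

lemma rooted_treeD:
  assumes "\<tau> \<in> rooted_trees (space M) T x" "y \<in> \<tau>"
  shows "y \<in> space M" and "\<exists>i. (T ^^ i) y = x" and "(x, y) \<in> E"
proof -
  obtain n where "\<tau> \<subseteq> (\<Union>i\<le>n. (T ^^ i) -` {x} \<inter> space M)"
    using assms(1) unfolding rooted_trees_def by blast
  then obtain i where i: "y \<in> space M" "(T ^^ i) y = x"
    using assms(2) by blast
  then show "y \<in> space M" "\<exists>i. (T ^^ i) y = x" by auto
  have "x \<in> space M" using i by auto
  then show "(x, y) \<in> E"
    using i by (intro orbit_relI[of x y 0 i]) auto
qed

lemma AE_finite_tree_sum_le_tree_bound:
  assumes g: "integrable M g"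
  shows "AE x in M. \<forall>n. \<forall>F\<in>rooted_trees (space M) T x. finite F \<longrightarrow>
    F \<subseteq> (\<Union>i\<le>n. (T ^^ i) -` {x} \<inter> space M) \<longrightarrow> (\<Sum>y\<in>F. g y * \<rho> x y) \<le> tree_bound g n x"
proof -
  have fibre: "AE x in M. \<forall>n. \<forall>F. finite F \<longrightarrow> F \<subseteq> T -` {x} \<inter> space M \<longrightarrow>
      (\<Sum>y\<in>F. max 0 (tree_bound g n y) * \<rho> x y) \<le> transfer (\<lambda>y. max 0 (tree_bound g n y)) x"
    unfolding AE_all_countable
    by (intro allI finite_fibre_sum_le_transfer integrable_max integrable_zero tree_bound_integrable g) simp
  obtain G where G: "AE x in M. x \<in> G" "G \<subseteq> space M"
    "\<And>x. x \<in> G \<Longrightarrow> \<forall>n. \<forall>F. finite F \<longrightarrow> F \<subseteq> T -` {x} \<inter> space M \<longrightarrow>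
      (\<Sum>y\<in>F. max 0 (tree_bound g n y) * \<rho> x y) \<le> transfer (\<lambda>y. max 0 (tree_bound g n y)) x"
    "\<And>y. y \<in> space M \<Longrightarrow> T y \<in> G \<Longrightarrow> y \<in> G"
    by (rule AE_backward[OF fibre]) (rule that)
  show ?thesis
    using G(1)
  proof eventually_elim
    case (elim x)
    then show ?case
      using tree_sum_le_tree_bound[OF G(2,4)] G(3) by auto
  qed
qed

text \<open>The invariant set given by the maximal inequality carries a nonnegative integral of \<open>g\<close>, so the
assumption makes it a null set.\<close>
lemma AE_finite_tree_sums_bounded:
  assumes g: "integrable M g"
    and neg: "\<And>A. A \<in> sets M \<Longrightarrow> T -` A \<inter> space M = A \<Longrightarrow> 0 \<le> (LINT x:A|M. g x) \<Longrightarrow> A \<in> null_sets M"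
  shows "AE x in M. \<exists>C. \<forall>F\<in>rooted_trees (space M) T x. finite F \<longrightarrow> (\<Sum>y\<in>F. g y * \<rho> x y) \<le> C"
proof -
  obtain A where A: "A \<in> sets M" "T -` A \<inter> space M = A" "0 \<le> (LINT x:A|M. g x)"
    "AE x in M. x \<notin> A \<longrightarrow> bdd_above (range (\<lambda>n. tree_bound g n x))"
    by (rule maximal_ergodic[OF g])
  have "AE x in M. x \<notin> A"
    by (rule AE_not_in[OF neg[OF A(1-3)]])
  with A(4) AE_finite_tree_sum_le_tree_bound[OF g] show ?thesis
  proof eventually_elim
    case (elim x)
    then obtain C where C: "\<And>n. tree_bound g n x \<le> C"
      by (auto simp: bdd_above_def)
    have "(\<Sum>y\<in>F. g y * \<rho> x y) \<le> C" if F: "F \<in> rooted_trees (space M) T x" "finite F" for F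
    proof -
      obtain n where "F \<subseteq> (\<Union>i\<le>n. (T ^^ i) -` {x} \<inter> space M)"
        using F unfolding rooted_trees_def by blast
      then have "(\<Sum>y\<in>F. g y * \<rho> x y) \<le> tree_bound g n x"
        using elim(2) F by blast
      with C[of n] show ?thesis by linarith
    qed
    then show ?case by blast
  qed
qed

text \<open>This reduces statements on infinite trees to finite ones: the paths from finitely many vertices to
the root form a finite tree.\<close>
lemma finite_subtree:
  assumes \<tau>: "\<tau> \<in> rooted_trees (space M) T x" and F: "F \<subseteq> \<tau>" "finite F"
  obtains F' where "finite F'" "F \<subseteq> F'" "F' \<subseteq> \<tau>" "F' \<in> rooted_trees (space M) T x"
proof -
  obtain n where n: "\<tau> \<subseteq> (\<Union>i\<le>n. (T ^^ i) -` {x} \<inter> space M)" and x: "x \<in> \<tau>"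
    and up: "\<And>y. y \<in> \<tau> \<Longrightarrow> y \<noteq> x \<Longrightarrow> T y \<in> \<tau>"
    using \<tau> unfolding rooted_trees_def by blast
  define F' where "F' = insert x (\<Union>y\<in>F. (\<lambda>j. (T ^^ j) y) ` {..n} \<inter> \<tau>)"
  have sub: "F' \<subseteq> \<tau>"
    using x by (auto simp: F'_def)
  have "F \<subseteq> F'"
  proof
    fix y assume "y \<in> F"
    moreover have "y = (T ^^ 0) y" by simp
    ultimately show "y \<in> F'"
      using F(1) unfolding F'_def by blast
  qed
  moreover have "T z \<in> F'" if z: "z \<in> F'" "z \<noteq> x" for z
  proof -
    obtain y j where y: "y \<in> F" "z = (T ^^ j) y" "z \<in> \<tau>"
      using z by (auto simp: F'_def)
    obtain i where i: "(T ^^ i) z = x"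
      using y(3) n by blast
    obtain l where l: "l \<le> n" "(T ^^ l) y = x" "y \<in> space M"
      using y(1) F(1) n by blast
    have "(T ^^ (i + j)) y = x"
      using i y(2) by (simp add: funpow_add)
    then have "i + j = l"
      using l by (intro level_unique[of y]) simp_all
    moreover have "i \<noteq> 0"
      using i z(2) by (intro notI) simp
    ultimately have "Suc j \<le> n" using l(1) by linarith
    moreover have "T z \<in> \<tau>" by (rule up[OF y(3) z(2)])
    moreover have "T z = (T ^^ Suc j) y" using y(2) by simp
    ultimately show ?thesis
      using y(1) unfolding F'_def by blast
  qed
  moreover have "x \<in> F'"
    by (simp add: F'_def)
  moreover have "F' \<subseteq> (\<Union>i\<le>n. (T ^^ i) -` {x} \<inter> space M)"
    using sub n by (rule order_trans)
  ultimately have "F \<subseteq> F' \<and> F' \<in> rooted_trees (space M) T x"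
    unfolding rooted_trees_def by blast
  moreover have "finite F'"
    using F(2) by (auto simp: F'_def)
  ultimately show thesis
    using that sub by blast
qed

text \<open>Every finite subset of a tree of height \<open>n\<close> lies in a finite subtree, so the partial sums of \<open>\<bar>f\<bar>\<close>
with weights \<open>\<rho>\<close> are bounded by the tree bound of \<open>\<bar>f\<bar>\<close> at level \<open>n\<close>.\<close>
lemma AE_trees_summable:
  assumes f: "integrable M f"
  shows "AE x in M. \<forall>\<tau>\<in>rooted_trees (space M) T x. (\<lambda>y. \<bar>f y\<bar> * \<rho> x y) summable_on \<tau>"
proof -
  let ?f = "\<lambda>x. \<bar>f x\<bar>"
  have f': "integrable M ?f" using f by simp
  show ?thesis
    using AE_finite_tree_sum_le_tree_bound[OF f']
  proof eventually_elim
    case (elim x)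
    show ?case
    proof
      fix \<tau> assume \<tau>: "\<tau> \<in> rooted_trees (space M) T x"
      obtain n where n: "\<tau> \<subseteq> (\<Union>i\<le>n. (T ^^ i) -` {x} \<inter> space M)"
        using \<tau> unfolding rooted_trees_def by blast
      have pos: "0 \<le> \<bar>f y\<bar> * \<rho> x y" if "y \<in> \<tau>" for y
        using rho_pos[OF rooted_treeD(3)[OF \<tau> that]] by simp
      show "(\<lambda>y. \<bar>f y\<bar> * \<rho> x y) summable_on \<tau>"
      proof (rule nonneg_bdd_above_summable_on)
        show "bdd_above (sum (\<lambda>y. \<bar>f y\<bar> * \<rho> x y) ` {F. F \<subseteq> \<tau> \<and> finite F})"
        proof (rule bdd_aboveI2[of _ _ "tree_bound ?f n x"])
          fix F assume "F \<in> {F. F \<subseteq> \<tau> \<and> finite F}"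
          then obtain F' where F': "finite F'" "F \<subseteq> F'" "F' \<subseteq> \<tau>" "F' \<in> rooted_trees (space M) T x"
            using finite_subtree[OF \<tau>] by blast
          have "(\<Sum>y\<in>F. \<bar>f y\<bar> * \<rho> x y) \<le> (\<Sum>y\<in>F'. \<bar>f y\<bar> * \<rho> x y)"
            using F' pos by (intro sum_mono2) auto
          also have "\<dots> \<le> tree_bound ?f n x"
            using elim F' n by (meson order_trans)
          finally show "(\<Sum>y\<in>F. \<bar>f y\<bar> * \<rho> x y) \<le> tree_bound ?f n x" .
        qed
      qed (rule pos)
    qed
  qed
qed

lemma infsum_tree_le:
  assumes \<tau>: "\<tau> \<in> rooted_trees (space M) T x" and sm: "h summable_on \<tau>"
    and le: "\<And>F. F \<in> rooted_trees (space M) T x \<Longrightarrow> finite F \<Longrightarrow> (\<Sum>y\<in>F. h y) \<le> (C :: real)"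
  shows "(\<Sum>\<^sub>\<infinity>y\<in>\<tau>. h y) \<le> C"
proof (rule ccontr)
  assume "\<not> ?thesis"
  then have "\<forall>\<^sub>F F in finite_subsets_at_top \<tau>. C < sum h F"
    using order_tendstoD(1)[OF infsum_tendsto[OF sm]] by simp
  then obtain F where F: "finite F" "F \<subseteq> \<tau>"
    "\<forall>F'. finite F' \<and> F \<subseteq> F' \<and> F' \<subseteq> \<tau> \<longrightarrow> C < sum h F'"
    unfolding eventually_finite_subsets_at_top by blast
  obtain F' where F': "finite F'" "F \<subseteq> F'" "F' \<subseteq> \<tau>" "F' \<in> rooted_trees (space M) T x"
    using finite_subtree[OF \<tau> F(2,1)] by blast
  then have "C < sum h F'"
    using F(3) by blast
  with le[OF F'(4,1)] show False by simp
qed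

lemma tree_weight_eq_infsum:
  assumes "\<tau> \<in> rooted_trees (space M) T x" and sm: "(\<lambda>y. \<rho> x y) summable_on \<tau>"
  shows "tree_weight \<rho> x \<tau> = ennreal (\<Sum>\<^sub>\<infinity>y\<in>\<tau>. \<rho> x y)"
proof -
  have pos: "0 \<le> \<rho> x y" if "y \<in> \<tau>" for y
    using rho_pos[OF rooted_treeD(3)[OF assms(1) that]] by simp
  have "((\<lambda>F. ennreal (\<Sum>y\<in>F. \<rho> x y)) \<longlongrightarrow> ennreal (\<Sum>\<^sub>\<infinity>y\<in>\<tau>. \<rho> x y)) (finite_subsets_at_top \<tau>)"
    by (intro tendsto_ennrealI infsum_tendsto sm)
  moreover have "\<forall>\<^sub>F F in finite_subsets_at_top \<tau>. ennreal (\<Sum>y\<in>F. \<rho> x y) = (\<Sum>y\<in>F. ennreal (\<rho> x y))"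
    unfolding eventually_finite_subsets_at_top
    by (intro exI[of _ "{}"]) (auto intro!: sum_ennreal[symmetric] pos)
  ultimately have "((\<lambda>y. ennreal (\<rho> x y)) has_sum ennreal (\<Sum>\<^sub>\<infinity>y\<in>\<tau>. \<rho> x y)) \<tau>"
    unfolding has_sum_def by (rule Lim_transform_eventually)
  then show ?thesis
    unfolding tree_weight_def by (rule infsumI)
qed

text \<open>For \<open>d > 0\<close> the function \<open>f - fb - d\<close> has negative integral over every invariant set of positive
measure, so by the maximal inequality its tree sums at \<open>x\<close> are bounded by some \<open>C\<close>. As \<open>fb\<close> is
constant along a tree, division by the weight \<open>w\<close> bounds the average of \<open>f\<close> by \<open>fb x + d + C / w\<close>,
and the last term is small for heavy trees.\<close>
lemma AE_tree_average_le:
  assumes f: "integrable M f" and fb: "integrable M fb"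
    and inv: "\<And>y. y \<in> space M \<Longrightarrow> fb (T y) = fb y"
    and eq: "\<And>A. A \<in> sets M \<Longrightarrow> T -` A \<inter> space M = A \<Longrightarrow> (LINT x:A|M. f x) = (LINT x:A|M. fb x)"
  shows "AE x in M. \<forall>\<epsilon>>0. \<exists>K>0. \<forall>\<tau>\<in>rooted_trees (space M) T x. tree_weight \<rho> x \<tau> \<ge> ennreal K \<longrightarrow>
    tree_average \<rho> f x \<tau> - fb x < \<epsilon>"
proof -
  let ?d = "\<lambda>m :: nat. 1 / real (Suc m)"
  let ?g = "\<lambda>m y. f y - fb y - ?d m"
  have g: "integrable M (?g m)" for m
    using f fb by simp
  have neg: "A \<in> null_sets M" if A: "A \<in> sets M" "T -` A \<inter> space M = A" and pos: "0 \<le> (LINT x:A|M. ?g m x)" for A m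
  proof -
    have int: "integrable M (\<lambda>x. indicator A x * h x)" if "integrable M h" for h :: "'a \<Rightarrow> real"
      using integrable_mult_indicator[OF A(1) that] by simp
    have "(LINT x:A|M. ?g m x) = (LINT x:A|M. f x) - (LINT x:A|M. fb x) - ?d m * measure M A"
      using int[OF f] int[OF fb] A(1)
      by (simp add: set_lebesgue_integral_def right_diff_distrib sets.Int_space_eq2 emeasure_eq_measure)
    then have "?d m * measure M A \<le> 0"
      using pos eq[OF A] by simp
    then have "measure M A \<le> 0"
      by (simp add: divide_le_0_iff)
    then have "measure M A = 0"
      using measure_nonneg[of M A] by linarith
    then show ?thesis
      using A(1) by (simp add: null_sets_def emeasure_eq_measure)
  qed
  have "AE x in M. \<forall>m. \<exists>C. \<forall>F\<in>rooted_trees (space M) T x. finite F \<longrightarrow> (\<Sum>y\<in>F. ?g m y * \<rho> x y) \<le> C"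
    unfolding AE_all_countable by (intro allI AE_finite_tree_sums_bounded g neg)
  moreover have "AE x in M. \<forall>\<tau>\<in>rooted_trees (space M) T x. (\<lambda>y. \<bar>f y\<bar> * \<rho> x y) summable_on \<tau>"
    by (rule AE_trees_summable[OF f])
  moreover have "AE x in M. \<forall>\<tau>\<in>rooted_trees (space M) T x. (\<lambda>y. \<bar>1\<bar> * \<rho> x y) summable_on \<tau>"
    by (rule AE_trees_summable) simp
  ultimately show ?thesis
  proof eventually_elim
    case (elim x)
    show ?case
    proof (intro allI impI)
      fix \<epsilon> :: real assume "\<epsilon> > 0"
      then obtain m where m: "?d m < \<epsilon> / 2"
        using nat_approx_posE[of "\<epsilon> / 2"] by auto
      obtain C where C: "\<And>F. F \<in> rooted_trees (space M) T x \<Longrightarrow> finite F \<Longrightarrow> (\<Sum>y\<in>F. ?g m y * \<rho> x y) \<le> C"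
        using elim(1) by blast
      \<comment> \<open>This makes \<open>C / w\<close> smaller than \<open>\<epsilon> / 2\<close> for every weight \<open>w\<close> that is at least \<open>K\<close>.\<close>
      define K where "K = 2 * (\<bar>C\<bar> + 1) / \<epsilon>"
      have K: "K > 0" "C < K * (\<epsilon> / 2)"
        using \<open>\<epsilon> > 0\<close> by (auto simp: K_def)
      have "tree_average \<rho> f x \<tau> - fb x < \<epsilon>"
        if \<tau>: "\<tau> \<in> rooted_trees (space M) T x" and heavy: "tree_weight \<rho> x \<tau> \<ge> ennreal K" for \<tau>
      proof -
        have rho_pos': "0 < \<rho> x y" if "y \<in> \<tau>" for y
          using rho_pos[OF rooted_treeD(3)[OF \<tau> that]] .
        have fb_eq: "fb y = fb x" if y: "y \<in> \<tau>" for y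
        proof -
          obtain i where i: "(T ^^ i) y = x"
            using rooted_treeD(2)[OF \<tau> y] by blast
          have "fb ((T ^^ i) y) = fb y" for i
            by (induction i) (use rooted_treeD(1)[OF \<tau> y] in \<open>auto simp: inv\<close>)
          then show "fb y = fb x" using i by metis
        qed
        have rho_sm: "(\<lambda>y. \<rho> x y) summable_on \<tau>"
          using elim(3) \<tau> by simp
        have f_sm: "(\<lambda>y. f y * \<rho> x y) summable_on \<tau>"
        proof (rule abs_summable_summable)
          have "(\<lambda>y. \<bar>f y\<bar> * \<rho> x y) summable_on \<tau>"
            using elim(2) \<tau> by blast
          then show "(\<lambda>y. norm (f y * \<rho> x y)) summable_on \<tau>"
            by (rule summable_on_cong[THEN iffD1, rotated]) (simp add: abs_mult rho_pos' less_imp_le)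
        qed
        define w where "w = (\<Sum>\<^sub>\<infinity>y\<in>\<tau>. \<rho> x y)"
        have weight: "tree_weight \<rho> x \<tau> = ennreal w"
          unfolding w_def by (rule tree_weight_eq_infsum[OF \<tau> rho_sm])
        have "w \<ge> 0"
          unfolding w_def by (rule infsum_nonneg) (simp add: rho_pos' less_imp_le)
        then have "w \<ge> K"
          using heavy K by (simp add: weight ennreal_le_iff)
        then have "w > 0" using K by linarith
        define S where "S = (\<Sum>\<^sub>\<infinity>y\<in>\<tau>. f y * \<rho> x y)"
        have g_eq: "?g m y * \<rho> x y = f y * \<rho> x y + (- (fb x + ?d m)) * \<rho> x y" if "y \<in> \<tau>" for y
          using fb_eq[OF that] by (simp add: algebra_simps)
        have g_sm: "(\<lambda>y. f y * \<rho> x y + (- (fb x + ?d m)) * \<rho> x y) summable_on \<tau>"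
          by (intro summable_on_add f_sm summable_on_cmult_right rho_sm)
        have "(\<Sum>\<^sub>\<infinity>y\<in>\<tau>. ?g m y * \<rho> x y) \<le> C"
          using g_sm summable_on_cong[OF g_eq, of \<tau> "\<lambda>y. y"] C
          by (intro infsum_tree_le[OF \<tau>]) auto
        also have "(\<Sum>\<^sub>\<infinity>y\<in>\<tau>. ?g m y * \<rho> x y) = (\<Sum>\<^sub>\<infinity>y\<in>\<tau>. f y * \<rho> x y + (- (fb x + ?d m)) * \<rho> x y)"
          by (rule infsum_cong) (rule g_eq)
        also have "\<dots> = S + (\<Sum>\<^sub>\<infinity>y\<in>\<tau>. (- (fb x + ?d m)) * \<rho> x y)"
          unfolding S_def by (intro infsum_add f_sm summable_on_cmult_right rho_sm)
        also have "(\<Sum>\<^sub>\<infinity>y\<in>\<tau>. (- (fb x + ?d m)) * \<rho> x y) = (- (fb x + ?d m)) * w"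
          unfolding w_def by (intro infsum_cmult_right rho_sm)
        finally have "S \<le> (fb x + ?d m) * w + C"
          by linarith
        also have "C < w * (\<epsilon> / 2)"
          using K(2) mult_right_mono[OF \<open>w \<ge> K\<close>, of "\<epsilon> / 2"] \<open>\<epsilon> > 0\<close> by linarith
        finally have "S < (fb x + ?d m + \<epsilon> / 2) * w"
          by (simp add: algebra_simps)
        then have "S / w < fb x + ?d m + \<epsilon> / 2"
          using \<open>w > 0\<close> by (rule pos_divide_less_eq[THEN iffD2, rotated])
        moreover have "tree_average \<rho> f x \<tau> = S / w"
          using \<open>w \<ge> 0\<close> by (simp add: tree_average_def weight S_def)
        ultimately show ?thesis using m by linarith
      qed
      with K(1) show "\<exists>K>0. \<forall>\<tau>\<in>rooted_trees (space M) T x. tree_weight \<rho> x \<tau> \<ge> ennreal K \<longrightarrow>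
          tree_average \<rho> f x \<tau> - fb x < \<epsilon>"
        by blast
    qed
  qed
qed

text \<open>The level set of \<open>u\<close> through \<open>y\<close> is exactly invariant, so the equation holds at every point and
not only almost everywhere.\<close>
lemma invariant_measurable_constant:
  fixes u :: "'a \<Rightarrow> real"
  assumes "u \<in> borel_measurable (invariant_algebra M T)" and y: "y \<in> space M"
  shows "u (T y) = u y"
proof -
  have "space (invariant_algebra M T) = space M"
    using subalgebra_invariant_algebra[OF T_measurable] by (simp add: subalgebra_def)
  then have "u -` {u y} \<inter> space M \<in> sets (invariant_algebra M T)"
    using measurable_sets[OF assms(1), of "{u y}"] by simp
  then have level: "u -` {u y} \<inter> space M \<in> {A \<in> sets M. T -` A \<inter> space M = A}"
    by (simp only: sets_invariant_algebra[OF T_measurable])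
  have "y \<in> T -` (u -` {u y} \<inter> space M) \<inter> space M"
    by (rule equalityD2[OF conjunct2[OF CollectD[OF level]], THEN subsetD]) (simp add: y)
  then show ?thesis by simp
qed

end

theorem theorem1p3:
  fixes M :: "'a measure"
    and T :: "'a \<Rightarrow> 'a"
    and \<rho> :: "'a \<Rightarrow> 'a \<Rightarrow> real"
    and f :: "'a \<Rightarrow> real"
  assumes "prob_space M"
    and "standard_borel M"
    and "measure_preserving_map M T"
    and "aperiodic_map (space M) T"
    and "countable_to_one (space M) T"
    and "T ` space M = space M"
    and "null_preserving M (orbit_rel (space M) T)"
    and "radon_nikodym_cocycle M (orbit_rel (space M) T) \<rho>"
    and "integrable M f"
  shows "AE x in M.
      (\<forall>\<tau>\<in>rooted_trees (space M) T x. (\<lambda>y. \<bar>f y\<bar> * \<rho> x y) summable_on \<tau>) \<and>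
      (\<forall>\<epsilon>>0. \<exists>K>0. \<forall>\<tau>\<in>rooted_trees (space M) T x. tree_weight \<rho> x \<tau> \<ge> ennreal K \<longrightarrow>
         \<bar>tree_average \<rho> f x \<tau> - real_cond_exp M (invariant_algebra M T) f x\<bar> < \<epsilon>)"
proof -
  interpret cocycle_system M T \<rho>
    using assms by (intro cocycle_system.intro cocycle_system_axioms.intro)
  interpret inv: finite_measure_subalgebra M "invariant_algebra M T"
    by unfold_locales (rule subalgebra_invariant_algebra[OF T_measurable])
  define fb where "fb = real_cond_exp M (invariant_algebra M T) f"
  have f: "integrable M f" by fact
  have fb: "integrable M fb"
    unfolding fb_def by (rule inv.real_cond_exp_int(1)[OF f])
  have fb_inv: "fb (T y) = fb y" if "y \<in> space M" for y
    unfolding fb_def using that by (intro invariant_measurable_constant) auto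
  have eq: "(LINT x:A|M. f x) = (LINT x:A|M. fb x)" if "A \<in> sets M" "T -` A \<inter> space M = A" for A
    unfolding fb_def using that
    by (intro inv.real_cond_exp_intA f) (simp add: sets_invariant_algebra)
  have upper: "AE x in M. \<forall>\<epsilon>>0. \<exists>K>0. \<forall>\<tau>\<in>rooted_trees (space M) T x. tree_weight \<rho> x \<tau> \<ge> ennreal K \<longrightarrow>
      tree_average \<rho> f x \<tau> - fb x < \<epsilon>"
    by (rule AE_tree_average_le[OF f fb fb_inv eq])
  have lower: "AE x in M. \<forall>\<epsilon>>0. \<exists>K>0. \<forall>\<tau>\<in>rooted_trees (space M) T x. tree_weight \<rho> x \<tau> \<ge> ennreal K \<longrightarrow>
      tree_average \<rho> (\<lambda>y. - f y) x \<tau> - (- fb x) < \<epsilon>"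
    by (rule AE_tree_average_le) (use f fb fb_inv eq in \<open>auto simp: set_lebesgue_integral_def\<close>)
  have minus: "tree_average \<rho> (\<lambda>y. - f y) x \<tau> = - tree_average \<rho> f x \<tau>" for x \<tau>
    by (simp add: tree_average_def infsum_uminus)
  show ?thesis
    using upper lower AE_trees_summable[OF f]
    unfolding fb_def[symmetric]
  proof eventually_elim
    case (elim x)
    show ?case
    proof (intro conjI allI impI)
      fix \<epsilon> :: real assume "\<epsilon> > 0"
      obtain K1 where K1: "K1 > 0" "\<And>\<tau>. \<tau> \<in> rooted_trees (space M) T x \<Longrightarrow> tree_weight \<rho> x \<tau> \<ge> ennreal K1 \<Longrightarrow>
          tree_average \<rho> f x \<tau> - fb x < \<epsilon>"
        using elim(1) \<open>\<epsilon> > 0\<close> by blast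
      obtain K2 where K2: "K2 > 0" "\<And>\<tau>. \<tau> \<in> rooted_trees (space M) T x \<Longrightarrow> tree_weight \<rho> x \<tau> \<ge> ennreal K2 \<Longrightarrow>
          - tree_average \<rho> f x \<tau> - - fb x < \<epsilon>"
        using elim(2) \<open>\<epsilon> > 0\<close> unfolding minus by blast
      show "\<exists>K>0. \<forall>\<tau>\<in>rooted_trees (space M) T x. tree_weight \<rho> x \<tau> \<ge> ennreal K \<longrightarrow>
          \<bar>tree_average \<rho> f x \<tau> - fb x\<bar> < \<epsilon>"
      proof (intro exI[of _ "max K1 K2"] conjI ballI impI)
        fix \<tau> assume \<tau>: "\<tau> \<in> rooted_trees (space M) T x" and "tree_weight \<rho> x \<tau> \<ge> ennreal (max K1 K2)"
        then have "tree_weight \<rho> x \<tau> \<ge> ennreal K1" "tree_weight \<rho> x \<tau> \<ge> ennreal K2"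
          using order_trans[OF ennreal_leI] by (metis max.cobounded1, metis max.cobounded2)
        from K1(2)[OF \<tau> this(1)] K2(2)[OF \<tau> this(2)]
        show "\<bar>tree_average \<rho> f x \<tau> - fb x\<bar> < \<epsilon>" by linarith
      qed (use K1(1) in simp)
    qed (use elim(3) in blast)
  qed
qed

end
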